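(* Let $\lambda$ be an infinite cardinal and assume the two-cardinal transfer principle $\langle\aleph_0,\aleph_1\rangle\rightarrow\langle\lambda,\lambda^+\rangle$. Let $L$ be a relational vocabulary with $|L|\le\lambda$, and for each $i<\lambda$ let $M_i$ and $N_i$ be elementarily equivalent $L$-structures. If $D$ is a regular filter on $\lambda$, then player II has a winning strategy in the Ehrenfeucht–Fraïssé game $\mathrm{EFG}_{\lambda^+}$ on $\prod_i M_i/D$ and $\prod_i N_i/D$.
   Context: The principle $\langle\aleph_0,\aleph_1\rangle\rightarrow\langle\lambda,\lambda^+\rangle$ means: for every first-order theory in a countable vocabulary containing a unary predicate $U$, if it has a model $A$ with $|A|=\aleph_1$ and $|U^A|=\aleph_0$, then it has a model $B$ with $|B|=\lambda^+$ and $|U^B|=\lambda$. A filter $D$ on $\lambda$ is regular if there is a family $\{A_\alpha:\alpha<\lambda\}\subseteq D$ such that every $i<\lambda$ belongs to only finitely many $A_\alpha$. For structures $M,N$ and an ordinal $\gamma$, the game $\mathrm{EFG}_\gamma$ on $M,N$ has $\gamma$ rounds; at round $\alpha<\gamma$ player I picks an element $x_\alpha\in M\cup N$ and player II answers with $y_\alpha$ in the other structure ($N$ if $x_\alpha\in M$, $M$ if $x_\alpha\in N$). The play determines a relation $\pi\subseteq M\times N$ consisting of the pairs played; II wins the play if $\pi$ is a partial isomorphism, otherwise I wins. *)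

theory Defs
  imports Complex_Main "HOL-Library.FuncSet" "HOL-Library.Countable_Set"
begin

unbundle cardinal_syntax

record ('f, 'r) vocabulary =
  funs :: "'f set"
  rels :: "'r set"
  fun_arity :: "'f \<Rightarrow> nat"
  rel_arity :: "'r \<Rightarrow> nat"

text \<open>Constant symbols are function symbols of arity 0.\<close>

abbreviation symbols :: "('f, 'r) vocabulary \<Rightarrow> ('f + 'r) set" where
  "symbols L \<equiv> funs L <+> rels L"

definition relational :: "('f, 'r) vocabulary \<Rightarrow> bool" where
  "relational L \<longleftrightarrow> funs L = {}"

datatype 'f tm = Var nat | App 'f "'f tm list"

datatype ('f, 'r) fm =
    Equal "'f tm" "'f tm"
  | Rel 'r "'f tm list"
  | Neg "('f, 'r) fm"
  | Conj "('f, 'r) fm" "('f, 'r) fm"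
  | Exists nat "('f, 'r) fm"

fun is_term :: "('f, 'r) vocabulary \<Rightarrow> 'f tm \<Rightarrow> bool" where
  "is_term L (Var n) \<longleftrightarrow> True"
| "is_term L (App f ts) \<longleftrightarrow>
     f \<in> funs L \<and> length ts = fun_arity L f \<and> (\<forall>t\<in>set ts. is_term L t)"

primrec is_formula :: "('f, 'r) vocabulary \<Rightarrow> ('f, 'r) fm \<Rightarrow> bool" where
  "is_formula L (Equal s t) \<longleftrightarrow> is_term L s \<and> is_term L t"
| "is_formula L (Rel R ts) \<longleftrightarrow>
     R \<in> rels L \<and> length ts = rel_arity L R \<and> (\<forall>t\<in>set ts. is_term L t)"
| "is_formula L (Neg \<phi>) \<longleftrightarrow> is_formula L \<phi>"
| "is_formula L (Conj \<phi> \<psi>) \<longleftrightarrow> is_formula L \<phi> \<and> is_formula L \<psi>"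
| "is_formula L (Exists n \<phi>) \<longleftrightarrow> is_formula L \<phi>"

fun tm_vars :: "'f tm \<Rightarrow> nat set" where
  "tm_vars (Var n) = {n}"
| "tm_vars (App f ts) = (\<Union>t\<in>set ts. tm_vars t)"

primrec free_vars :: "('f, 'r) fm \<Rightarrow> nat set" where
  "free_vars (Equal s t) = tm_vars s \<union> tm_vars t"
| "free_vars (Rel R ts) = (\<Union>t\<in>set ts. tm_vars t)"
| "free_vars (Neg \<phi>) = free_vars \<phi>"
| "free_vars (Conj \<phi> \<psi>) = free_vars \<phi> \<union> free_vars \<psi>"
| "free_vars (Exists n \<phi>) = free_vars \<phi> - {n}"

definition sentences :: "('f, 'r) vocabulary \<Rightarrow> ('f, 'r) fm set" where
  "sentences L = {\<phi>. is_formula L \<phi> \<and> free_vars \<phi> = {}}"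

text \<open>
  The interpretations are total functions on lists; only their values at symbols of the
  vocabulary, applied to lists over the universe whose length is the arity of the symbol,
  are relevant.
\<close>

record ('f, 'r, 'a) fo_structure =
  universe :: "'a set"
  fun_interp :: "'f \<Rightarrow> 'a list \<Rightarrow> 'a"
  rel_interp :: "'r \<Rightarrow> 'a list \<Rightarrow> bool"

definition is_structure :: "('f, 'r) vocabulary \<Rightarrow> ('f, 'r, 'a) fo_structure \<Rightarrow> bool" where
  "is_structure L M \<longleftrightarrow>
     universe M \<noteq> {} \<and>
     (\<forall>f\<in>funs L. \<forall>xs\<in>lists (universe M).
        length xs = fun_arity L f \<longrightarrow> fun_interp M f xs \<in> universe M)"

primrec tm_val :: "('f, 'r, 'a) fo_structure \<Rightarrow> (nat \<Rightarrow> 'a) \<Rightarrow> 'f tm \<Rightarrow> 'a" where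
  "tm_val M e (Var n) = e n"
| "tm_val M e (App f ts) = fun_interp M f (map (tm_val M e) ts)"

primrec sat :: "('f, 'r, 'a) fo_structure \<Rightarrow> (nat \<Rightarrow> 'a) \<Rightarrow> ('f, 'r) fm \<Rightarrow> bool" where
  "sat M e (Equal s t) \<longleftrightarrow> tm_val M e s = tm_val M e t"
| "sat M e (Rel R ts) \<longleftrightarrow> rel_interp M R (map (tm_val M e) ts)"
| "sat M e (Neg \<phi>) \<longleftrightarrow> \<not> sat M e \<phi>"
| "sat M e (Conj \<phi> \<psi>) \<longleftrightarrow> sat M e \<phi> \<and> sat M e \<psi>"
| "sat M e (Exists n \<phi>) \<longleftrightarrow> (\<exists>a\<in>universe M. sat M (e(n := a)) \<phi>)"

definition holds :: "('f, 'r, 'a) fo_structure \<Rightarrow> ('f, 'r) fm \<Rightarrow> bool" where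
  "holds M \<phi> \<longleftrightarrow> (\<forall>e. range e \<subseteq> universe M \<longrightarrow> sat M e \<phi>)"

definition is_model ::
  "('f, 'r) vocabulary \<Rightarrow> ('f, 'r) fm set \<Rightarrow> ('f, 'r, 'a) fo_structure \<Rightarrow> bool" where
  "is_model L T M \<longleftrightarrow> is_structure L M \<and> (\<forall>\<phi>\<in>T. holds M \<phi>)"

definition elementarily_equivalent ::
  "('f, 'r) vocabulary \<Rightarrow> ('f, 'r, 'a) fo_structure \<Rightarrow> ('f, 'r, 'b) fo_structure \<Rightarrow> bool" where
  "elementarily_equivalent L M N \<longleftrightarrow> (\<forall>\<phi>\<in>sentences L. holds M \<phi> \<longleftrightarrow> holds N \<phi>)"

definition unary_interp :: "('f, 'r, 'a) fo_structure \<Rightarrow> 'r \<Rightarrow> 'a set" where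
  "unary_interp M U = {a \<in> universe M. rel_interp M U [a]}"

text \<open>
  The principle \<open>\<langle>\<kappa>, \<kappa>\<^sup>+\<rangle> \<rightarrow> \<langle>lam, lam\<^sup>+\<rangle>\<close>. Fixing the types of symbols and of elements loses no
  generality: the symbols of a countable vocabulary can be renamed to natural numbers, and every
  structure of cardinality \<open>\<kappa>\<^sup>+\<close> has an isomorphic copy with universe contained in the type
  \<open>'k set\<close>, since \<open>cardSuc \<kappa>\<close> is a relation on that type; similarly for \<open>lam\<^sup>+\<close>.
\<close>

definition two_cardinal_transfer :: "'k rel \<Rightarrow> 'l rel \<Rightarrow> bool" where
  "two_cardinal_transfer \<kappa> lam \<longleftrightarrow>
     (\<forall>(L :: (nat, nat) vocabulary) U T.
        countable (symbols L) \<and> U \<in> rels L \<and> rel_arity L U = 1 \<and> T \<subseteq> sentences L \<longrightarrow>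
        (\<exists>A :: (nat, nat, 'k set) fo_structure.
           is_model L T A \<and> |universe A| =o cardSuc \<kappa> \<and> |unary_interp A U| =o \<kappa>) \<longrightarrow>
        (\<exists>B :: (nat, nat, 'l set) fo_structure.
           is_model L T B \<and> |universe B| =o cardSuc lam \<and> |unary_interp B U| =o lam))"

text \<open>
  Filters on a set \<open>I\<close> are represented by the filters on the ambient type that contain \<open>I\<close>;
  \<open>A\<close> belongs to the filter \<open>D\<close> iff \<open>\<forall>\<^sub>F i in D. i \<in> A\<close>.
\<close>

definition filter_on :: "'i set \<Rightarrow> 'i filter \<Rightarrow> bool" where
  "filter_on I D \<longleftrightarrow> (\<forall>\<^sub>F i in D. i \<in> I)"

definition regular_filter :: "'l rel \<Rightarrow> 'l filter \<Rightarrow> bool" where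
  "regular_filter lam D \<longleftrightarrow>
     filter_on (Field lam) D \<and>
     (\<exists>A :: 'l \<Rightarrow> 'l set.
        (\<forall>\<alpha>\<in>Field lam. A \<alpha> \<subseteq> Field lam \<and> (\<forall>\<^sub>F i in D. i \<in> A \<alpha>)) \<and>
        (\<forall>i\<in>Field lam. finite {\<alpha> \<in> Field lam. i \<in> A \<alpha>}))"

definition eq_mod :: "'i set \<Rightarrow> 'i filter \<Rightarrow> ('i \<Rightarrow> 'a set) \<Rightarrow> (('i \<Rightarrow> 'a) \<times> ('i \<Rightarrow> 'a)) set" where
  "eq_mod I D S =
     {(f, g). f \<in> (\<Pi>\<^sub>E i\<in>I. S i) \<and> g \<in> (\<Pi>\<^sub>E i\<in>I. S i) \<and> (\<forall>\<^sub>F i in D. f i = g i)}"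

text \<open>
  Neither interpretation depends on the choice of representatives, so \<open>SOME\<close> and \<open>\<exists>\<close> below
  are immaterial.
\<close>

definition reduced_product ::
  "'i set \<Rightarrow> 'i filter \<Rightarrow> ('i \<Rightarrow> ('f, 'r, 'a) fo_structure) \<Rightarrow> ('f, 'r, ('i \<Rightarrow> 'a) set) fo_structure" where
  "reduced_product I D M =
     (let E = eq_mod I D (\<lambda>i. universe (M i)) in
      \<lparr> universe = (\<Pi>\<^sub>E i\<in>I. universe (M i)) // E,
        fun_interp = (\<lambda>F Xs.
          E `` {\<lambda>i\<in>I. fun_interp (M i) F (map (\<lambda>X. (SOME f. f \<in> X) i) Xs)}),
        rel_interp = (\<lambda>R Xs.
          \<exists>fs. list_all2 (\<in>) fs Xs \<and> (\<forall>\<^sub>F i in D. rel_interp (M i) R (map (\<lambda>f. f i) fs))) \<rparr>)"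

text \<open>Only adequate for relational vocabularies: function symbols are ignored.\<close>

definition partial_isomorphism ::
  "('f, 'r) vocabulary \<Rightarrow> ('f, 'r, 'a) fo_structure \<Rightarrow> ('f, 'r, 'b) fo_structure \<Rightarrow> ('a \<times> 'b) set \<Rightarrow> bool"
  where
  "partial_isomorphism L M N \<pi> \<longleftrightarrow>
     \<pi> \<subseteq> universe M \<times> universe N \<and>
     (\<forall>(a, b)\<in>\<pi>. \<forall>(a', b')\<in>\<pi>. a = a' \<longleftrightarrow> b = b') \<and>
     (\<forall>R\<in>rels L. \<forall>ps\<in>lists \<pi>. length ps = rel_arity L R \<longrightarrow>
        (rel_interp M R (map fst ps) \<longleftrightarrow> rel_interp N R (map snd ps)))"

text \<open>
  The length of the game is a well-order \<open>\<gamma>\<close>, whose field is the set of rounds. The two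
  structures are made disjoint by \<open>Inl\<close> and \<open>Inr\<close>; \<open>x \<alpha>\<close> and \<open>y \<alpha>\<close> are the moves of players I and II
  in round \<open>\<alpha>\<close>.
\<close>

definition I_legal ::
  "'g rel \<Rightarrow> ('f, 'r, 'a) fo_structure \<Rightarrow> ('f, 'r, 'b) fo_structure \<Rightarrow> ('g \<Rightarrow> 'a + 'b) \<Rightarrow> bool" where
  "I_legal \<gamma> M N x \<longleftrightarrow> (\<forall>\<alpha>\<in>Field \<gamma>. x \<alpha> \<in> universe M <+> universe N)"

definition II_legal ::
  "'g rel \<Rightarrow> ('f, 'r, 'a) fo_structure \<Rightarrow> ('f, 'r, 'b) fo_structure \<Rightarrow>
   ('g \<Rightarrow> 'a + 'b) \<Rightarrow> ('g \<Rightarrow> 'a + 'b) \<Rightarrow> bool" where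
  "II_legal \<gamma> M N x y \<longleftrightarrow>
     (\<forall>\<alpha>\<in>Field \<gamma>. y \<alpha> \<in> (case x \<alpha> of Inl _ \<Rightarrow> Inr ` universe N | Inr _ \<Rightarrow> Inl ` universe M))"

definition played_pairs :: "'g rel \<Rightarrow> ('g \<Rightarrow> 'a + 'b) \<Rightarrow> ('g \<Rightarrow> 'a + 'b) \<Rightarrow> ('a \<times> 'b) set" where
  "played_pairs \<gamma> x y =
     {(a, b). \<exists>\<alpha>\<in>Field \<gamma>. x \<alpha> = Inl a \<and> y \<alpha> = Inr b \<or> x \<alpha> = Inr b \<and> y \<alpha> = Inl a}"

text \<open>
  A strategy of player II gives the answer in round \<open>\<alpha>\<close> from the moves of I in the
  rounds \<open>\<le> \<alpha>\<close> and those of II in the rounds \<open>< \<alpha>\<close>.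
\<close>

type_synonym ('g, 'm) strategy = "'g \<Rightarrow> ('g \<Rightarrow> 'm) \<Rightarrow> ('g \<Rightarrow> 'm) \<Rightarrow> 'm"

definition follows :: "'g rel \<Rightarrow> ('g, 'm) strategy \<Rightarrow> ('g \<Rightarrow> 'm) \<Rightarrow> ('g \<Rightarrow> 'm) \<Rightarrow> bool" where
  "follows \<gamma> \<sigma> x y \<longleftrightarrow>
     (\<forall>\<alpha>\<in>Field \<gamma>. y \<alpha> = \<sigma> \<alpha> (restrict x (under \<gamma> \<alpha>)) (restrict y (underS \<gamma> \<alpha>)))"

definition II_wins_EFG ::
  "'g rel \<Rightarrow> ('f, 'r) vocabulary \<Rightarrow> ('f, 'r, 'a) fo_structure \<Rightarrow> ('f, 'r, 'b) fo_structure \<Rightarrow> bool" where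
  "II_wins_EFG \<gamma> L M N \<longleftrightarrow>
     (\<exists>\<sigma> :: ('g, 'a + 'b) strategy. \<forall>x y.
        I_legal \<gamma> M N x \<and> follows \<gamma> \<sigma> x y \<longrightarrow>
        II_legal \<gamma> M N x y \<and> partial_isomorphism L M N (played_pairs \<gamma> x y))"

end

theory Submission
  imports Defs "HOL-Library.Nat_Bijection" "HOL-Library.Countable_Set_Type"
begin

text \<open>
  On \<open>\<omega>\<^sub>1\<close> there are coherent finite sets \<open>u\<^sub>n(z)\<close>, increasing in \<open>n\<close> with union the predecessors of \<open>z\<close>.
  They define increasing tree orders with finite branches, and a branch has one of countably many
  isomorphism types. These properties of trees and types are first-order and make initial segments
  small, so the two-cardinal principle yields such a system on a linear order of size \<open>\<lambda>\<^sup>+\<close> with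
  \<open>\<lambda>\<close> trees and types (the branches need no longer be finite). Given finitely many triples (tree \<open>c\<close>, type \<open>p\<close>,
  type \<open>q\<close>), a suborder of the trees in which \<open>x\<close> is below \<open>y\<close> whenever \<open>x\<close>, \<open>y\<close> have types \<open>p\<close>, \<open>q\<close> and
  \<open>x\<close> is below \<open>y\<close> in tree \<open>c\<close> can be chosen as a tree of bounded finite height. By regularity of \<open>D\<close>,
  each \<open>i < \<lambda>\<close> gets finitely many triples such that each triple is met \<open>D\<close>-almost everywhere; this gives finite
  coherent sets \<open>u i z\<close> of rounds before \<open>z\<close>, of size at most \<open>n i\<close>, with \<open>y \<in> u i z\<close> for
  \<open>D\<close>-almost all \<open>i\<close> whenever \<open>y < z\<close>.

  In round \<open>z\<close>, player II answers in coordinate \<open>i\<close> as in a finite back-and-forth game on \<open>M i\<close>, \<open>N i\<close> with finitely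
  many relations, taking only the rounds in \<open>u i z\<close> into account; by coherence, this
  position extends the one reached at the largest element of \<open>u i z\<close>, and the bound \<open>n i\<close> says
  how many moves must be kept in reserve.
\<close>

section \<open>Coherent finite sets and types on \<open>\<omega>\<^sub>1\<close>\<close>

text \<open>\<open>u\<close> is a candidate for \<open>f z\<close>, while \<open>f\<close> holds the
  families already chosen. Only values of \<open>f\<close> at predecessors of \<open>z\<close> are
  consulted, as well-founded choice requires.\<close>

definition coherent_at ::
  "'a rel \<Rightarrow> ('a \<Rightarrow> nat \<Rightarrow> 'a set) \<Rightarrow> 'a \<Rightarrow> (nat \<Rightarrow> 'a set) \<Rightarrow> bool" where
  "coherent_at r f z u \<longleftrightarrow>
     (\<forall>n. finite (u n) \<and> u n \<subseteq> underS r z \<and> (\<forall>y\<in>u n. f y n = u n \<inter> underS r y)) \<and>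
     mono u \<and> (\<Union>n. u n) = underS r z"

text \<open>The predecessors of \<open>z\<close> are exhausted along a cofinal increasing sequence
  \<open>s\<close>. At stage \<open>n\<close> the new set is the one that \<open>f\<close> attaches
  to a single member of \<open>s\<close>, together with that member, so coherence is inherited; how
  far along \<open>s\<close> this member lies depends on how much of \<open>s\<close> is visible at
  stage \<open>n\<close>.\<close>

lemma coherent_at_extend:
  assumes r: "Well_order r" and cnt: "countable (underS r z)"
    and f: "\<And>y. y \<in> underS r z \<Longrightarrow> coherent_at r f y (f y)"
  shows "\<exists>u. coherent_at r f z u"
proof (cases "underS r z = {}")
  case True
  then show ?thesis
    by (intro exI[of _ "\<lambda>n. {}"]) (auto simp: coherent_at_def mono_def)
next
  case False
  interpret wo: wo_rel r using r by (simp add: wo_rel_def)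
  define e where "e = from_nat_into (underS r z)"
  have e: "range e = underS r z"
    using False cnt by (simp add: e_def range_from_nat_into)
  \<comment> \<open>Running maxima of an enumeration: cofinal, but only weakly increasing, as there
    may be a largest predecessor.\<close>
  define s where "s = rec_nat (e 0) (\<lambda>k y. wo.max2 y (e (Suc k)))"
  have s0: "s 0 = e 0" and sS: "\<And>k. s (Suc k) = wo.max2 (s k) (e (Suc k))"
    by (simp_all add: s_def)
  have uF: "underS r z \<subseteq> Field r" by (auto simp: underS_def Field_def)
  have s: "s k \<in> underS r z" for k
  proof (induction k)
    case 0
    then show ?case using e s0 by auto
  next
    case (Suc k)
    moreover have "e (Suc k) \<in> underS r z" using e by auto
    ultimately show ?case unfolding sS wo.max2_def by auto
  qed
  have smono: "(s k, s (Suc k)) \<in> r" and es: "(e k, s k) \<in> r" for k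
  proof -
    have "s k \<in> Field r" "e (Suc k) \<in> Field r" for k using s e uF by auto
    then have *: "(s k, s (Suc k)) \<in> r" "(e (Suc k), s (Suc k)) \<in> r" for k
      unfolding sS using wo.max2_greater by blast+
    show "(s k, s (Suc k)) \<in> r" by (rule *)
    show "(e k, s k) \<in> r"
    proof (cases k)
      case 0
      have "e 0 \<in> Field r" using e uF by auto
      then show ?thesis using wo.REFL 0 s0 by (auto simp: refl_on_def)
    qed (use * in auto)
  qed
  \<comment> \<open>\<open>f y n\<close> omits \<open>y\<close>. With \<open>y\<close> added it
    approximates the closed segment up to \<open>y\<close>, and such a set contains the one at each
    of its own elements.\<close>
  define cl where "cl n y = insert y (f y n)" for n y
  have clfin: "finite (cl n y)" and clU: "cl n y \<subseteq> underS r z"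
    and clm: "mono (\<lambda>n. cl n y)" and cld: "\<And>x. (x, y) \<in> r \<Longrightarrow> \<exists>n. x \<in> cl n y"
    if "y \<in> underS r z" for n y
  proof -
    note c = f[OF that, unfolded coherent_at_def]
    show "finite (cl n y)" using c by (simp add: cl_def)
    have "underS r y \<subseteq> underS r z"
      using that underS_incr[OF wo.TRANS wo.ANTISYM] by (auto simp: underS_def)
    then show "cl n y \<subseteq> underS r z" using c that by (auto simp: cl_def)
    show "mono (\<lambda>n. cl n y)" using c by (fastforce simp: cl_def mono_def)
    show "\<exists>n. x \<in> cl n y" if "(x, y) \<in> r" for x
      using c that by (auto simp: cl_def underS_def)
  qed
  have coh: "f x n = cl n y \<inter> underS r x" if "y \<in> underS r z" "x \<in> cl n y" for x y n
  proof -
    have c: "f y n \<subseteq> underS r y" "\<And>w. w \<in> f y n \<Longrightarrow> f w n = f y n \<inter> underS r w"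
      using f[OF that(1)] unfolding coherent_at_def by blast+
    show ?thesis
    proof (cases "x = y")
      case True
      then show ?thesis using c(1) by (auto simp: cl_def underS_def)
    next
      case False
      then have x: "x \<in> f y n" using that(2) by (simp add: cl_def)
      then have "y \<notin> underS r x"
        using c(1) wo.ANTISYM by (auto simp: underS_def antisym_def)
      then show ?thesis using c(2)[OF x] by (auto simp: cl_def)
    qed
  qed
  \<comment> \<open>At stage \<open>n\<close> each member of the chain up to \<open>s k\<close>
    already sees the one before it. This passes to smaller \<open>k\<close> and to larger
    \<open>n\<close>.\<close>
  define P where "P n k \<longleftrightarrow> (\<forall>j<k. s j \<in> cl n (s (Suc j)))" for n k
  have Pm: "P n k" if "P m k" "m \<le> n" for m n k
    using that clm[OF s] unfolding P_def mono_def by blast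
  have Pex: "\<exists>n. P n k" for k
  proof (induction k)
    case (Suc k)
    then obtain n where n: "P n k" by blast
    obtain m where m: "s k \<in> cl m (s (Suc k))" using cld[OF s smono] by blast
    have "s k \<in> cl (max m n) (s (Suc k))" using m clm[OF s] unfolding mono_def
      by (meson max.cobounded1 subsetD)
    then have "P (max m n) (Suc k)"
      using Pm[OF n, of "max m n"] by (auto simp: P_def less_Suc_eq)
    then show ?case by blast
  qed (simp add: P_def)
  have Pcl: "cl n (s j) \<subseteq> cl n (s k)" if "P n k" "j \<le> k" for n j k
    using that(2,1)
  proof (induction k rule: dec_induct)
    case (step k)
    have "s k \<in> cl n (s (Suc k))" using step.prems by (simp add: P_def)
    then have "cl n (s k) \<subseteq> cl n (s (Suc k))"
      using coh[OF s, of "s k" n "Suc k"] by (auto simp: cl_def)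
    moreover have "P n k" using step.prems by (simp add: P_def)
    ultimately show ?case using step.IH by blast
  qed simp
  \<comment> \<open>By \<open>Pcl\<close> the sets in this union increase with \<open>k\<close>, so
    it equals its last term; \<open>k \<le> n\<close> keeps it finite even if \<open>P n k\<close>
    holds for all \<open>k\<close>.\<close>
  define u where "u n = (\<Union>k\<in>{k. k \<le> n \<and> P n k}. cl n (s k))" for n
  have "coherent_at r f z u"
    unfolding coherent_at_def
  proof (intro conjI allI ballI)
    fix n
    show "finite (u n)" using clfin[OF s] by (auto simp: u_def)
    show "u n \<subseteq> underS r z" using clU[OF s] by (auto simp: u_def)
    show "f y n = u n \<inter> underS r y" if y: "y \<in> u n" for y
    proof
      obtain k where k: "P n k" "y \<in> cl n (s k)" "k \<le> n" using y by (auto simp: u_def)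
      show "f y n \<subseteq> u n \<inter> underS r y" using coh[OF s k(2)] k by (auto simp: u_def)
      show "u n \<inter> underS r y \<subseteq> f y n"
      proof
        fix x assume x: "x \<in> u n \<inter> underS r y"
        then obtain l where l: "P n l" "x \<in> cl n (s l)" by (auto simp: u_def)
        have K: "P n (max k l)" using k l by (simp add: max_def)
        have "x \<in> cl n (s (max k l))" "y \<in> cl n (s (max k l))"
          using Pcl[OF K] k l by (meson max.cobounded1 max.cobounded2 subsetD)+
        then show "x \<in> f y n" using coh[OF s] x by blast
      qed
    qed
  next
    show "mono u"
    proof
      fix m n :: nat assume mn: "m \<le> n"
      show "u m \<subseteq> u n"
      proof
        fix x assume "x \<in> u m"
        then obtain k where "k \<le> m" "P m k" "x \<in> cl m (s k)" by (auto simp: u_def)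
        then have "k \<le> n" "P n k" "x \<in> cl n (s k)"
          using mn Pm clm[OF s] unfolding mono_def by (auto, blast)
        then show "x \<in> u n" by (auto simp: u_def)
      qed
    qed
  next
    show "(\<Union>n. u n) = underS r z"
    proof
      show "(\<Union>n. u n) \<subseteq> underS r z" using clU[OF s] by (auto simp: u_def)
      show "underS r z \<subseteq> (\<Union>n. u n)"
      proof
        fix x assume "x \<in> underS r z"
        then obtain k where x: "x = e k" using e by blast
        obtain m where m: "x \<in> cl m (s k)" using cld[OF s es] x by blast
        obtain n where n: "P n k" using Pex by blast
        let ?N = "max k (max m n)"
        have "P ?N k" using Pm[OF n] by simp
        moreover have "x \<in> cl ?N (s k)" using m clm[OF s] unfolding mono_def
          by (meson max.cobounded1 max.coboundedI2 subsetD)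
        ultimately have "x \<in> u ?N" unfolding u_def by (intro UN_I[of k]) auto
        then show "x \<in> (\<Union>n. u n)" by blast
      qed
    qed
  qed
  then show ?thesis by blast
qed

lemma coherent_sets_exist:
  assumes r: "Well_order r" and cnt: "\<And>z. countable (underS r z)"
  shows "\<exists>f. \<forall>z. coherent_at r f z (f z)"
proof -
  have "wf (r - Id)" using r by (simp add: well_order_on_def)
  then show ?thesis
  proof (rule dependent_wf_choice)
    fix f g :: "'a \<Rightarrow> nat \<Rightarrow> 'a set" and z u
    assume "\<And>y. (y, z) \<in> r - Id \<Longrightarrow> f y = g y"
    then have "f y = g y" if "y \<in> underS r z" for y using that by (auto simp: underS_def)
    then show "coherent_at r f z u = coherent_at r g z u"
      unfolding coherent_at_def by (metis subsetD)
  next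
    fix z f
    assume "\<And>y. (y, z) \<in> r - Id \<Longrightarrow> coherent_at r f y (f y)"
    then show "\<exists>u. coherent_at r f z u"
      by (intro coherent_at_extend[OF r cnt]) (auto simp: underS_def)
  qed
qed

text \<open>
  The type of \<open>z\<close> is a code of the hereditarily finite set of pairs (type of \<open>y\<close>, \<open>h y z\<close>) with \<open>y \<in> f z\<close>.
\<close>

lemma type_codes_exist:
  assumes r: "Well_order r" and f: "\<And>z. f z \<subseteq> underS r z"
  shows "\<exists>\<tau> :: 'a \<Rightarrow> nat. \<forall>z. \<tau> z = set_encode ((\<lambda>y. prod_encode (\<tau> y, h y z)) ` f z)"
proof -
  have "wf (r - Id)" using r by (simp add: well_order_on_def)
  then show ?thesis
  proof (rule dependent_wf_choice)
    fix \<tau> \<tau>' :: "'a \<Rightarrow> nat" and z x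
    assume "\<And>y. (y, z) \<in> r - Id \<Longrightarrow> \<tau> y = \<tau>' y"
    then have "\<tau> y = \<tau>' y" if "y \<in> f z" for y using that f[of z] by (auto simp: underS_def)
    then have "(\<lambda>y. prod_encode (\<tau> y, h y z)) ` f z = (\<lambda>y. prod_encode (\<tau>' y, h y z)) ` f z"
      by (intro image_cong) auto
    then show "(x = set_encode ((\<lambda>y. prod_encode (\<tau> y, h y z)) ` f z)) =
               (x = set_encode ((\<lambda>y. prod_encode (\<tau>' y, h y z)) ` f z))" by simp
  qed blast
qed

text \<open>
  \<open>U\<close> indexes the trees and names the types; \<open>S c x y\<close> means that \<open>x\<close> is below \<open>y\<close> in tree \<open>c\<close>, and \<open>t c x\<close> is the
  type of the branch of tree \<open>c\<close> below \<open>x\<close>.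
\<close>

locale tree_system =
  fixes V U :: "'v set" and le :: "'v \<Rightarrow> 'v \<Rightarrow> bool"
    and S :: "'v \<Rightarrow> 'v \<Rightarrow> 'v \<Rightarrow> bool" and t :: "'v \<Rightarrow> 'v \<Rightarrow> 'v"
  assumes U_sub: "U \<subseteq> V"
    and t_in: "\<lbrakk>c \<in> V; x \<in> V\<rbrakk> \<Longrightarrow> t c x \<in> U"
    and le_total: "\<lbrakk>c \<in> U; d \<in> U\<rbrakk> \<Longrightarrow> le c d \<or> le d c"
    and le_trans: "\<lbrakk>c \<in> U; d \<in> U; e \<in> U; le c d; le d e\<rbrakk> \<Longrightarrow> le c e"
    and S_mono: "\<lbrakk>c \<in> U; d \<in> U; x \<in> V; y \<in> V; le c d; S c x y\<rbrakk> \<Longrightarrow> S d x y"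
    and S_trans: "\<lbrakk>c \<in> U; x \<in> V; y \<in> V; z \<in> V; S c x y; S c y z\<rbrakk> \<Longrightarrow> S c x z"
    and S_tree: "\<lbrakk>c \<in> U; x \<in> V; y \<in> V; z \<in> V; S c x z; S c y z\<rbrakk> \<Longrightarrow> x = y \<or> S c x y \<or> S c y x"
    and S_total: "\<lbrakk>x \<in> V; y \<in> V; x \<noteq> y\<rbrakk> \<Longrightarrow> \<exists>c\<in>U. S c x y \<or> S c y x"
    and t_neq: "\<lbrakk>c \<in> U; x \<in> V; y \<in> V; S c x y\<rbrakk> \<Longrightarrow> t c x \<noteq> t c y"
    and t_mono: "\<lbrakk>c \<in> U; d \<in> U; x \<in> V; y \<in> V; le d c; t c x = t c y\<rbrakk> \<Longrightarrow> t d x = t d y"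
    and t_iso: "\<lbrakk>c \<in> U; x \<in> V; y \<in> V; z \<in> V; t c y = t c z; S c x y\<rbrakk> \<Longrightarrow>
      \<exists>w\<in>V. S c w z \<and> t c w = t c x \<and> (\<forall>d\<in>U. le d c \<and> S d x y \<longrightarrow> S d w z)"

lemma tree_system_exists:
  fixes r :: "'a rel"
  assumes r: "Well_order r" and cnt: "\<And>z. countable (underS r z)"
    and j: "inj j" "range (j :: nat \<Rightarrow> 'a) \<subseteq> Field r"
  shows "\<exists>le S t. tree_system (Field r) (range j) le S t"
proof -
  interpret wo: wo_rel r using r by (simp add: wo_rel_def)
  obtain f where f: "\<And>z. coherent_at r f z (f z)"
    using coherent_sets_exist[OF r cnt] by blast
  have fin: "finite (f z n)" and sub: "f z n \<subseteq> underS r z"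
    and coh: "y \<in> f z n \<Longrightarrow> f y n = f z n \<inter> underS r y"
    and mon: "m \<le> n \<Longrightarrow> f z m \<subseteq> f z n" and un: "(\<Union>n. f z n) = underS r z" for y z m n
    using f[of z] unfolding coherent_at_def mono_def by blast+
  \<comment> \<open>The stage at which \<open>y\<close> enters the sets of \<open>z\<close>. Stored
    in the code of a branch, it lets a code at level \<open>n\<close> describe all lower levels
    too.\<close>
  define \<rho> where "\<rho> y z = (LEAST n. y \<in> f z n)" for y z
  have \<rho>: "y \<in> f z n \<longleftrightarrow> y \<in> underS r z \<and> \<rho> y z \<le> n" for y z n
  proof
    assume *: "y \<in> f z n"
    then show "y \<in> underS r z \<and> \<rho> y z \<le> n" using sub unfolding \<rho>_def by (blast intro: Least_le)
  next
    assume *: "y \<in> underS r z \<and> \<rho> y z \<le> n"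
    then obtain k where "y \<in> f z k" using un by blast
    then have "y \<in> f z (\<rho> y z)" unfolding \<rho>_def by (rule LeastI)
    then show "y \<in> f z n" using mon * by blast
  qed
  have "\<exists>\<tau>. \<forall>z. \<tau> z = set_encode ((\<lambda>y. prod_encode (\<tau> y, \<rho> y z)) ` f z n)" for n
    by (rule type_codes_exist[OF r sub])
  then obtain \<tau> where \<tau>: "\<And>n z. \<tau> n z = set_encode ((\<lambda>y. prod_encode (\<tau> n y, \<rho> y z)) ` f z n)"
    by metis
  have \<tau>dec: "set_decode (\<tau> n z) = (\<lambda>y. prod_encode (\<tau> n y, \<rho> y z)) ` f z n" for n z
    by (subst \<tau>) (simp add: fin)
  \<comment> \<open>Source of \<open>t_neq\<close>: the code of a set exceeds its elements, and a
    pair code is at least its first component.\<close>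
  have \<tau>less: "\<tau> n y < \<tau> n z" if "y \<in> f z n" for n y z
  proof -
    have *: "prod_encode (\<tau> n y, \<rho> y z) \<in> set_decode (\<tau> n z)" using that by (simp add: \<tau>dec)
    have "\<tau> n y \<le> prod_encode (\<tau> n y, \<rho> y z)" by (rule le_prod_encode_1)
    also have "\<dots> < 2 ^ prod_encode (\<tau> n y, \<rho> y z)" by (rule less_exp)
    also have "\<dots> = set_encode {prod_encode (\<tau> n y, \<rho> y z)}" by simp
    also have "\<dots> \<le> \<tau> n z"
      using * by (intro subset_decode_imp_le) (subst set_encode_inverse, auto)
    finally show ?thesis .
  qed
  have \<tau>iso: "\<exists>w. w \<in> f z n \<and> \<tau> n w = \<tau> n x \<and> \<rho> w z = \<rho> x y"
    if "\<tau> n y = \<tau> n z" "x \<in> f y n" for n x y z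
  proof -
    have "prod_encode (\<tau> n x, \<rho> x y) \<in> set_decode (\<tau> n z)"
      using that \<tau>dec[of n y] by auto
    then show ?thesis unfolding \<tau>dec by auto
  qed
  \<comment> \<open>The labels \<open>\<rho>\<close> single out the pairs that survive at level
    \<open>m\<close>, so the code at level \<open>m\<close> can be read off the code at level
    \<open>n\<close>.\<close>
  have \<tau>mono: "\<tau> n y = \<tau> n z \<Longrightarrow> m \<le> n \<Longrightarrow> \<tau> m y = \<tau> m z" for n m y z
  proof (induction y arbitrary: z rule: wo.well_order_induct)
    case (1 y)
    note hyp = 1(1) and eq = 1(2) and mn = 1(3)
    have enc: "prod_encode (\<tau> m x, \<rho> x y) \<in> (\<lambda>y. prod_encode (\<tau> m y, \<rho> y z)) ` f z m"
      if eq: "\<tau> n y = \<tau> n z" and x: "x \<in> f y m" and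
        IH: "\<And>w. \<tau> n x = \<tau> n w \<Longrightarrow> \<tau> m x = \<tau> m w" for x y z
    proof -
      have "x \<in> f y n" using x mon[OF mn] by blast
      then obtain w where w: "w \<in> f z n" "\<tau> n w = \<tau> n x" "\<rho> w z = \<rho> x y"
        using \<tau>iso[OF eq] by blast
      then have "w \<in> f z m" using x \<rho> by auto
      moreover have "\<tau> m x = \<tau> m w" by (rule IH) (use w(2) in simp)
      ultimately show ?thesis using w by (intro image_eqI[of _ _ w]) auto
    qed
    have IH: "\<And>x w. x \<in> f y n \<Longrightarrow> \<tau> n x = \<tau> n w \<Longrightarrow> \<tau> m x = \<tau> m w"
    proof -
      fix x w assume "x \<in> f y n" "\<tau> n x = \<tau> n w"
      moreover from this have "x \<noteq> y \<and> (x, y) \<in> r" using sub[of y n] by (auto simp: underS_def)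
      ultimately show "\<tau> m x = \<tau> m w" using hyp mn by blast
    qed
    \<comment> \<open>The induction hypothesis speaks of predecessors of \<open>y\<close> only; for
      a predecessor of \<open>z\<close>, a partner below \<open>y\<close> of the same type
      mediates.\<close>
    have IH': "\<tau> m x = \<tau> m w" if x: "x \<in> f z n" "\<tau> n x = \<tau> n w" for x w
    proof -
      obtain v where "v \<in> f y n" "\<tau> n v = \<tau> n x" using \<tau>iso[OF eq[symmetric] x(1)] by blast
      then have "\<tau> m v = \<tau> m x" "\<tau> m v = \<tau> m w" using IH x(2) by metis+
      then show ?thesis by (rule trans[OF sym])
    qed
    have "(\<lambda>x. prod_encode (\<tau> m x, \<rho> x y)) ` f y m = (\<lambda>x. prod_encode (\<tau> m x, \<rho> x z)) ` f z m"
    proof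
      show "(\<lambda>x. prod_encode (\<tau> m x, \<rho> x y)) ` f y m \<subseteq> (\<lambda>x. prod_encode (\<tau> m x, \<rho> x z)) ` f z m"
      proof (rule image_subsetI)
        fix x assume "x \<in> f y m"
        with mon[OF mn] have "x \<in> f y n" by blast
        show "prod_encode (\<tau> m x, \<rho> x y) \<in> (\<lambda>x. prod_encode (\<tau> m x, \<rho> x z)) ` f z m"
          by (rule enc[OF eq \<open>x \<in> f y m\<close> IH[OF \<open>x \<in> f y n\<close>]])
      qed
      show "(\<lambda>x. prod_encode (\<tau> m x, \<rho> x z)) ` f z m \<subseteq> (\<lambda>x. prod_encode (\<tau> m x, \<rho> x y)) ` f y m"
      proof (rule image_subsetI)
        fix x assume "x \<in> f z m"
        with mon[OF mn] have "x \<in> f z n" by blast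
        show "prod_encode (\<tau> m x, \<rho> x z) \<in> (\<lambda>x. prod_encode (\<tau> m x, \<rho> x y)) ` f y m"
          by (rule enc[OF eq[symmetric] \<open>x \<in> f z m\<close> IH'[OF \<open>x \<in> f z n\<close>]])
      qed
    qed
    then show ?case using \<tau>[of m y] \<tau>[of m z] by simp
  qed
  \<comment> \<open>Elements of \<open>range j\<close> name both levels and types. Elsewhere
    \<open>c\<close> is arbitrary, but the types still lie in \<open>range j\<close>, as
    \<open>t_in\<close> demands for all of the field.\<close>
  define c where "c = inv j"
  have cj [simp]: "c (j n) = n" for n using j(1) by (simp add: c_def)
  have uF: "y \<in> Field r" if "y \<in> f z n" for y z n
    using that sub unfolding underS_def Field_def by blast
  have "tree_system (Field r) (range j) (\<lambda>a b. c a \<le> c b) (\<lambda>a x y. x \<in> f y (c a)) (\<lambda>a x. j (\<tau> (c a) x))"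
  proof
    fix a x y z assume "a \<in> range j" "x \<in> f y (c a)" "y \<in> f z (c a)"
    then show "x \<in> f z (c a)" using coh by blast
  next
    fix a x y z assume *: "x \<in> f z (c a)" "y \<in> f z (c a)" "x \<in> Field r" "y \<in> Field r"
    then have "x = y \<or> x \<in> underS r y \<or> y \<in> underS r x"
      using wo.TOTALS unfolding underS_def by blast
    then show "x = y \<or> x \<in> f y (c a) \<or> y \<in> f x (c a)" using * coh by blast
  next
    fix x y assume "x \<in> Field r" "y \<in> Field r" "x \<noteq> y"
    then have "x \<in> underS r y \<or> y \<in> underS r x"
      using wo.TOTALS unfolding underS_def by blast
    then obtain n where "x \<in> f y n \<or> y \<in> f x n" using un by blast
    then show "\<exists>a\<in>range j. x \<in> f y (c a) \<or> y \<in> f x (c a)" by auto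
  next
    fix a x y assume "x \<in> f y (c a)"
    then show "j (\<tau> (c a) x) \<noteq> j (\<tau> (c a) y)" using \<tau>less j(1) by (metis injD less_irrefl)
  next
    fix a b x y assume "c b \<le> c a" "j (\<tau> (c a) x) = j (\<tau> (c a) y)"
    then show "j (\<tau> (c b) x) = j (\<tau> (c b) y)" using \<tau>mono j(1) by (metis injD)
  next
    fix a x y z assume *: "j (\<tau> (c a) y) = j (\<tau> (c a) z)" "x \<in> f y (c a)"
    then have "\<tau> (c a) y = \<tau> (c a) z" using j(1) by (simp add: inj_eq)
    \<comment> \<open>Equal values of \<open>\<rho>\<close> place \<open>w\<close> below
      \<open>z\<close> at the same levels as \<open>x\<close> below \<open>y\<close>; this gives the
      clause on lower trees.\<close>
    then obtain w where "w \<in> f z (c a)" "\<tau> (c a) w = \<tau> (c a) x" "\<rho> w z = \<rho> x y"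
      using \<tau>iso * by blast
    then show "\<exists>w\<in>Field r. w \<in> f z (c a) \<and> j (\<tau> (c a) w) = j (\<tau> (c a) x) \<and>
        (\<forall>d\<in>range j. c d \<le> c a \<and> x \<in> f y (c d) \<longrightarrow> w \<in> f z (c d))"
      using uF \<rho> by (intro bexI[of _ w]) auto
  next
    fix a b x y assume "c a \<le> c b" "x \<in> f y (c a)"
    then show "x \<in> f y (c b)" using mon by blast
  qed (use j in auto)
  then show ?thesis by blast
qed

section \<open>Trees of finite height\<close>

text \<open>Stated for a total preorder, because triples are compared by their first components
  only.\<close>

lemma finite_total_max:
  assumes "finite A" "A \<noteq> {}" and A: "A \<subseteq> B"
    and tot: "\<And>x y. \<lbrakk>x \<in> B; y \<in> B\<rbrakk> \<Longrightarrow> le x y \<or> le y x"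
    and tr: "\<And>x y z. \<lbrakk>x \<in> B; y \<in> B; z \<in> B; le x y; le y z\<rbrakk> \<Longrightarrow> le x z"
  shows "\<exists>m\<in>A. \<forall>x\<in>A. le x m"
  using assms(1-3)
proof (induction A rule: finite_ne_induct)
  case (singleton x)
  then show ?case using tot by auto
next
  case (insert x A)
  then obtain m where m: "m \<in> A" "\<forall>y\<in>A. le y m" by blast
  show ?case
  proof (cases "le x m")
    case False
    then have "le m x" "le x x" using tot[of x m] tot[of x x] insert.prems m by auto
    then have "\<forall>y\<in>insert x A. le y x" using m insert.prems tr by (metis insert_iff subsetD)
    then show ?thesis by blast
  qed (use m in auto)
qed

context tree_system
begin

definition fits :: "'v \<times> 'v \<times> 'v \<Rightarrow> 'v \<Rightarrow> 'v \<Rightarrow> bool" where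
  "fits w x y \<longleftrightarrow> (case w of (c, p, q) \<Rightarrow> S c x y \<and> t c x = p \<and> t c y = q)"

text \<open>The last clause is the invariant of the induction: above all levels of \<open>W\<close>,
  the type of a point determines the types of its \<open>Q\<close>-predecessors. The clause before
  it keeps \<open>Q\<close> inside the trees of \<open>W\<close>, which later fixes its
  direction.\<close>

definition good_tree :: "('v \<times> 'v \<times> 'v) set \<Rightarrow> nat \<Rightarrow> ('v \<times> 'v) set \<Rightarrow> bool" where
  "good_tree W n Q \<longleftrightarrow>
     Q \<subseteq> V \<times> V \<and> trans Q \<and>
     (\<forall>x y z. (x, z) \<in> Q \<and> (y, z) \<in> Q \<longrightarrow> x = y \<or> (x, y) \<in> Q \<or> (y, x) \<in> Q) \<and>
     (\<forall>z. finite {x. (x, z) \<in> Q} \<and> card {x. (x, z) \<in> Q} \<le> n) \<and>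
     (\<forall>w\<in>W. \<forall>x\<in>V. \<forall>y\<in>V. fits w x y \<longrightarrow> (x, y) \<in> Q) \<and>
     (\<forall>(x, y)\<in>Q. \<exists>w\<in>W. S (fst w) x y) \<and>
     (\<forall>c\<in>U. (\<forall>w\<in>W. le (fst w) c) \<longrightarrow>
        (\<forall>(x, y)\<in>Q. \<forall>z\<in>V. t c y = t c z \<longrightarrow> (\<exists>v. (v, z) \<in> Q \<and> t c v = t c x)))"

text \<open>Since \<open>c\<close> bounds the levels of \<open>W\<close>, all of \<open>Q\<close>
  lies in tree \<open>c\<close> and the invariant applies at \<open>c\<close>. The new triple
  contributes the part \<open>Z\<close> of tree \<open>c\<close> on finitely many types; its
  branches are short because types along a branch differ. As \<open>Q O Z\<close> lies in
  \<open>Z\<close>, the relation \<open>Q \<union> Z \<union> Z O Q\<close> is already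
  transitive.\<close>

lemma good_tree_insert:
  assumes Q: "good_tree W n Q" and W: "W \<subseteq> U \<times> U \<times> U" and c: "c \<in> U"
    and max: "\<And>w. w \<in> W \<Longrightarrow> le (fst w) c"
  shows "\<exists>n' Q'. good_tree (insert (c, p, q) W) n' Q'"
proof -
  have QV: "Q \<subseteq> V \<times> V" and Qt: "\<And>x y z. (x, y) \<in> Q \<Longrightarrow> (y, z) \<in> Q \<Longrightarrow> (x, z) \<in> Q"
    and Qtree: "\<And>x y z. (x, z) \<in> Q \<Longrightarrow> (y, z) \<in> Q \<Longrightarrow> x = y \<or> (x, y) \<in> Q \<or> (y, x) \<in> Q"
    and Qfin: "\<And>z. finite {x. (x, z) \<in> Q}" "\<And>z. card {x. (x, z) \<in> Q} \<le> n"
    and QW: "\<And>w x y. w \<in> W \<Longrightarrow> x \<in> V \<Longrightarrow> y \<in> V \<Longrightarrow> fits w x y \<Longrightarrow> (x, y) \<in> Q"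
    and QS: "\<And>x y. (x, y) \<in> Q \<Longrightarrow> \<exists>w\<in>W. S (fst w) x y"
    and Qiso: "\<And>d x y z. \<lbrakk>d \<in> U; \<And>w. w \<in> W \<Longrightarrow> le (fst w) d; (x, y) \<in> Q; z \<in> V; t d y = t d z\<rbrakk> \<Longrightarrow>
      \<exists>v. (v, z) \<in> Q \<and> t d v = t d x"
  proof -
    note q = Q[unfolded good_tree_def]
    show "Q \<subseteq> V \<times> V" using q by (elim conjE)
    have "trans Q" using q by (elim conjE)
    then show "\<And>x y z. (x, y) \<in> Q \<Longrightarrow> (y, z) \<in> Q \<Longrightarrow> (x, z) \<in> Q" by (rule transD)
    have "\<forall>x y z. (x, z) \<in> Q \<and> (y, z) \<in> Q \<longrightarrow> x = y \<or> (x, y) \<in> Q \<or> (y, x) \<in> Q"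
      using q by (elim conjE)
    then show "\<And>x y z. (x, z) \<in> Q \<Longrightarrow> (y, z) \<in> Q \<Longrightarrow> x = y \<or> (x, y) \<in> Q \<or> (y, x) \<in> Q" by blast
    have "\<forall>z. finite {x. (x, z) \<in> Q} \<and> card {x. (x, z) \<in> Q} \<le> n" using q by (elim conjE)
    then show "\<And>z. finite {x. (x, z) \<in> Q}" "\<And>z. card {x. (x, z) \<in> Q} \<le> n" by auto
    have "\<forall>w\<in>W. \<forall>x\<in>V. \<forall>y\<in>V. fits w x y \<longrightarrow> (x, y) \<in> Q" using q by (elim conjE)
    then show "\<And>w x y. w \<in> W \<Longrightarrow> x \<in> V \<Longrightarrow> y \<in> V \<Longrightarrow> fits w x y \<Longrightarrow> (x, y) \<in> Q" by blast
    have "\<forall>(x, y)\<in>Q. \<exists>w\<in>W. S (fst w) x y" using q by (elim conjE)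
    then show "\<And>x y. (x, y) \<in> Q \<Longrightarrow> \<exists>w\<in>W. S (fst w) x y" by auto
    have "\<forall>c\<in>U. (\<forall>w\<in>W. le (fst w) c) \<longrightarrow>
        (\<forall>(x, y)\<in>Q. \<forall>z\<in>V. t c y = t c z \<longrightarrow> (\<exists>v. (v, z) \<in> Q \<and> t c v = t c x))"
      using q by (elim conjE)
    then show "\<And>d x y z. \<lbrakk>d \<in> U; \<And>w. w \<in> W \<Longrightarrow> le (fst w) d; (x, y) \<in> Q; z \<in> V; t d y = t d z\<rbrakk> \<Longrightarrow>
      \<exists>v. (v, z) \<in> Q \<and> t d v = t d x" by fastforce
  qed
  have QSc: "S c x y" if xy: "(x, y) \<in> Q" for x y
  proof -
    obtain w where w: "w \<in> W" "S (fst w) x y" using QS xy by blast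
    moreover have "fst w \<in> U" using W w by auto
    ultimately show ?thesis using S_mono[of "fst w" c x y] c max QV xy by auto
  qed
  \<comment> \<open>Adding the types of the \<open>Q\<close>-predecessors makes \<open>Z\<close> below absorb \<open>Q\<close> on the left.\<close>
  define Y where "Y = {p, q} \<union> {t c x | x y. (x, y) \<in> Q \<and> t c y \<in> {p, q}}"
  have Yfin: "finite Y"
  proof -
    \<comment> \<open>By the invariant at \<open>c\<close>, a single point \<open>z\<close> of type
      \<open>s\<close> shows all types occurring \<open>Q\<close>-below points of type
      \<open>s\<close>.\<close>
    have "finite {t c x | x y. (x, y) \<in> Q \<and> t c y = s}" for s
    proof (cases "\<exists>z\<in>V. t c z = s")
      case True
      then obtain z where z: "z \<in> V" "t c z = s" by blast
      have "{t c x | x y. (x, y) \<in> Q \<and> t c y = s} \<subseteq> t c ` {x. (x, z) \<in> Q}"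
        using Qiso[OF c max _ z(1)] z(2) by (auto simp: image_iff) metis
      then show ?thesis using Qfin(1)[of z] finite_surj by blast
    next
      case False
      then have "{t c x | x y. (x, y) \<in> Q \<and> t c y = s} = {}" using QV by auto
      then show ?thesis by (simp only: finite.emptyI)
    qed
    then have "finite ({t c x | x y. (x, y) \<in> Q \<and> t c y = p} \<union> {t c x | x y. (x, y) \<in> Q \<and> t c y = q})"
      by blast
    moreover have "Y \<subseteq> {p, q} \<union> ({t c x | x y. (x, y) \<in> Q \<and> t c y = p} \<union> {t c x | x y. (x, y) \<in> Q \<and> t c y = q})"
      unfolding Y_def by blast
    ultimately show ?thesis using finite_subset by blast
  qed
  \<comment> \<open>One round of closing is enough: the invariant moves the \<open>Q\<close>-edge
    into \<open>y\<close> to an edge into \<open>a\<close>, and transitivity of \<open>Q\<close>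
    carries it up to \<open>b\<close>.\<close>
  have Ycl: "t c x \<in> Y" if xy: "(x, y) \<in> Q" and Y: "t c y \<in> Y" for x y
  proof (cases "t c y \<in> {p, q}")
    case True
    then show ?thesis using xy unfolding Y_def by blast
  next
    case False
    then obtain a b where ab: "t c y = t c a" "(a, b) \<in> Q" "t c b \<in> {p, q}"
      using Y unfolding Y_def by auto
    then obtain v where "(v, a) \<in> Q" "t c v = t c x"
      using Qiso[OF c max xy, of a] QV by blast
    then have "(v, b) \<in> Q" using Qt ab by blast
    then have "t c v \<in> Y" using ab(3) unfolding Y_def by blast
    then show ?thesis using \<open>t c v = t c x\<close> by simp
  qed
  define Z where "Z = {(x, y). x \<in> V \<and> y \<in> V \<and> S c x y \<and> t c x \<in> Y \<and> t c y \<in> Y}"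
  have Zt: "(x, z) \<in> Z" if "(x, y) \<in> Z" "(y, z) \<in> Z" for x y z
    using that S_trans[OF c, of x y z] unfolding Z_def by auto
  have Ztree: "x = y \<or> (x, y) \<in> Z \<or> (y, x) \<in> Z" if "(x, z) \<in> Z" "(y, z) \<in> Z" for x y z
    using that S_tree[OF c, of x y z] unfolding Z_def by auto
  have QZ: "(x, y) \<in> Z" if "(x, y) \<in> Q" "t c y \<in> Y" for x y
    using that QSc[OF that(1)] Ycl[OF that] QV unfolding Z_def by auto
  have ZY2: "t c x \<in> Y" "t c y \<in> Y" if "(x, y) \<in> Z" for x y
    using that unfolding Z_def by auto
  define Q' where "Q' = Q \<union> Z \<union> Z O Q"
  have Q'I: "(x, y) \<in> Q \<Longrightarrow> (x, y) \<in> Q'" "(x, y) \<in> Z \<Longrightarrow> (x, y) \<in> Q'"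
    "(x, y) \<in> Z \<Longrightarrow> (y, z) \<in> Q \<Longrightarrow> (x, z) \<in> Q'" for x y z
    unfolding Q'_def by auto
  have Q'E: "(x, z) \<in> Q \<or> (\<exists>y. (x, y) \<in> Z \<and> (y = z \<or> (y, z) \<in> Q))" if "(x, z) \<in> Q'" for x z
    using that unfolding Q'_def by auto
  have Q'S: "S c x y" if "(x, y) \<in> Q'" for x y
    using Q'E[OF that] QSc S_trans[OF c, of x _ y] QV unfolding Z_def by blast
  have Zinj: "inj_on (t c) {x. (x, z) \<in> Z}" for z
  proof (rule inj_onI, rule ccontr)
    fix x y assume *: "x \<in> {x. (x, z) \<in> Z}" "y \<in> {x. (x, z) \<in> Z}" "t c x = t c y" "x \<noteq> y"
    then have "(x, y) \<in> Z \<or> (y, x) \<in> Z" using Ztree by blast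
    then show False using t_neq[OF c, of x y] t_neq[OF c, of y x] *(3) unfolding Z_def by auto
  qed
  have ZY: "t c ` {x. (x, z) \<in> Z} \<subseteq> Y" for z unfolding Z_def by auto
  have Zfin: "finite {x. (x, z) \<in> Z}" and Zcard: "card {x. (x, z) \<in> Z} \<le> card Y" for z
    using inj_on_finite[OF Zinj ZY Yfin] card_inj_on_le[OF Zinj ZY Yfin] by blast+
  \<comment> \<open>Besides its \<open>Q\<close>-predecessors, \<open>z\<close> receives the
    \<open>Z\<close>-predecessors of itself and of at most \<open>n\<close> further points; hence
    the bound \<open>n + Suc n * card Y\<close>.\<close>
  have Q'pre: "{x. (x, z) \<in> Q'} = {x. (x, z) \<in> Q} \<union> (\<Union>y\<in>insert z {x. (x, z) \<in> Q}. {x. (x, y) \<in> Z})" for z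
    unfolding Q'_def by auto
  have "good_tree (insert (c, p, q) W) (n + Suc n * card Y) Q'"
    unfolding good_tree_def
  proof (intro conjI)
    show "Q' \<subseteq> V \<times> V" using QV unfolding Q'_def Z_def by auto
    show "trans Q'"
    proof (rule transI)
      fix x y z assume xy: "(x, y) \<in> Q'" and yz: "(y, z) \<in> Q'"
      show "(x, z) \<in> Q'"
        using Q'E[OF yz]
      proof (elim disjE[of "(y, z) \<in> Q"] exE conjE)
        assume "(y, z) \<in> Q"
        then show ?thesis using Q'E[OF xy] Qt Q'I by metis
      next
        fix w assume w: "(y, w) \<in> Z" "w = z \<or> (w, z) \<in> Q"
        \<comment> \<open>A \<open>Q\<close>-edge into a point with type in \<open>Y\<close> is a
          \<open>Z\<close>-edge, so the whole path into \<open>y\<close> collapses to one step of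
          \<open>Z\<close>.\<close>
        have "(x, y) \<in> Z" using Q'E[OF xy] QZ[OF _ ZY2(1)[OF w(1)]] Zt by blast
        then have "(x, w) \<in> Z" using Zt w by blast
        then show ?thesis using Q'I w by blast
      qed
    qed
    show "\<forall>z. finite {x. (x, z) \<in> Q'} \<and> card {x. (x, z) \<in> Q'} \<le> n + Suc n * card Y"
    proof (intro allI conjI)
      fix z
      have pre: "finite {x. (x, z) \<in> Q}" "card {x. (x, z) \<in> Q} \<le> n" by (rule Qfin)+
      show "finite {x. (x, z) \<in> Q'}" unfolding Q'pre using pre(1) Zfin by simp
      have "card {x. (x, z) \<in> Q'} \<le> card {x. (x, z) \<in> Q} + card (\<Union>y\<in>insert z {x. (x, z) \<in> Q}. {x. (x, y) \<in> Z})"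
        unfolding Q'pre by (rule card_Un_le)
      also have "card (\<Union>y\<in>insert z {x. (x, z) \<in> Q}. {x. (x, y) \<in> Z}) \<le>
          (\<Sum>y\<in>insert z {x. (x, z) \<in> Q}. card {x. (x, y) \<in> Z})"
        using pre(1) by (intro card_UN_le) simp
      also have "\<dots> \<le> (\<Sum>y\<in>insert z {x. (x, z) \<in> Q}. card Y)" by (intro sum_mono Zcard)
      also have "\<dots> = card (insert z {x. (x, z) \<in> Q}) * card Y" by simp
      also have "\<dots> \<le> Suc n * card Y"
        using pre by (intro mult_le_mono1) (simp add: card_insert_if)
      finally show "card {x. (x, z) \<in> Q'} \<le> n + Suc n * card Y" using pre(2) by linarith
    qed
  next
    show "\<forall>x y z. (x, z) \<in> Q' \<and> (y, z) \<in> Q' \<longrightarrow> x = y \<or> (x, y) \<in> Q' \<or> (y, x) \<in> Q'"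
    proof (intro allI impI)
      fix x y z assume "(x, z) \<in> Q' \<and> (y, z) \<in> Q'"
      then have xz: "(x, z) \<in> Q'" and yz: "(y, z) \<in> Q'" by auto
      have QQ: "x = y \<or> (x, y) \<in> Q' \<or> (y, x) \<in> Q'"
        if xz: "(x, z) \<in> Q" and yw: "(y, w) \<in> Z" and wz: "w = z \<or> (w, z) \<in> Q" for x y w
      proof -
        \<comment> \<open>\<open>x\<close> is first compared with \<open>w\<close> in
          \<open>Q\<close>. If it is strictly below \<open>w\<close>, both \<open>x\<close> and
          \<open>y\<close> are \<open>Z\<close>-below \<open>w\<close>; otherwise \<open>y\<close>
          is below \<open>x\<close>.\<close>
        have "x = w \<or> (x, w) \<in> Q \<or> (w, x) \<in> Q" using xz wz Qtree by blast
        then show ?thesis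
          using Ztree[OF _ yw] QZ[OF _ ZY2(2)[OF yw]] yw Q'I by blast
      qed
      have ZZ: "x = y \<or> (x, y) \<in> Q' \<or> (y, x) \<in> Q'"
        if xv: "(x, v) \<in> Z" and yw: "(y, w) \<in> Z" and vw: "v = w \<or> (v, w) \<in> Q" for x y v w
      proof -
        have "(x, w) \<in> Z" using vw xv Zt[OF xv QZ[OF _ ZY2(2)[OF yw]]] by blast
        then show ?thesis using Ztree yw Q'I by blast
      qed
      show "x = y \<or> (x, y) \<in> Q' \<or> (y, x) \<in> Q'"
      proof (cases "(x, z) \<in> Q")
        case xzQ: True
        show ?thesis
        proof (cases "(y, z) \<in> Q")
          case True
          then show ?thesis using xzQ Qtree Q'I by metis
        next
          case False
          then obtain w where "(y, w) \<in> Z" "w = z \<or> (w, z) \<in> Q" using Q'E[OF yz] by blast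
          then show ?thesis by (rule QQ[OF xzQ])
        qed
      next
        case False
        then obtain v where v: "(x, v) \<in> Z" "v = z \<or> (v, z) \<in> Q" using Q'E[OF xz] by blast
        show ?thesis
        proof (cases "(y, z) \<in> Q")
          case True
          then show ?thesis using QQ[OF _ v] by blast
        next
          case False
          then obtain w where w: "(y, w) \<in> Z" "w = z \<or> (w, z) \<in> Q" using Q'E[OF yz] by blast
          then have "(v = w \<or> (v, w) \<in> Q) \<or> (w = v \<or> (w, v) \<in> Q)" using v Qtree by blast
          then show ?thesis using ZZ[OF v(1) w(1)] ZZ[OF w(1) v(1)] by blast
        qed
      qed
    qed
  next
    show "\<forall>w\<in>insert (c, p, q) W. \<forall>x\<in>V. \<forall>y\<in>V. fits w x y \<longrightarrow> (x, y) \<in> Q'"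
    proof (intro ballI impI)
      fix w x y assume w: "w \<in> insert (c, p, q) W" and xy: "x \<in> V" "y \<in> V" "fits w x y"
      show "(x, y) \<in> Q'"
      proof (cases "w \<in> W")
        case True
        then show ?thesis using QW xy Q'I by blast
      next
        case False
        then have "(x, y) \<in> Z" using w xy unfolding fits_def Z_def Y_def by auto
        then show ?thesis by (rule Q'I)
      qed
    qed
  next
    show "\<forall>(x, y)\<in>Q'. \<exists>w\<in>insert (c, p, q) W. S (fst w) x y"
      using Q'S by auto
  next
    show "\<forall>d\<in>U. (\<forall>w\<in>insert (c, p, q) W. le (fst w) d) \<longrightarrow>
        (\<forall>(x, y)\<in>Q'. \<forall>z\<in>V. t d y = t d z \<longrightarrow> (\<exists>v. (v, z) \<in> Q' \<and> t d v = t d x))"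
    proof (intro ballI impI)
      fix d xy
      assume d: "d \<in> U" "\<forall>w\<in>insert (c, p, q) W. le (fst w) d" and xy: "xy \<in> Q'"
      then have cd: "le c d" and dmax: "\<And>w. w \<in> W \<Longrightarrow> le (fst w) d" by auto
      have Qd: "\<exists>v. (v, z) \<in> Q \<and> t d v = t d x"
        if "(x, y) \<in> Q" "z \<in> V" "t d y = t d z" for x y z
        by (rule Qiso[OF d(1) dmax that])
      \<comment> \<open>\<open>t_iso\<close> is applied at level \<open>d\<close>; its clause on
        lower trees recovers \<open>S c v z\<close>, and \<open>t_mono\<close> brings the types down
        to level \<open>c\<close>, where membership in \<open>Z\<close> is decided.\<close>
      have Zd: "\<exists>v. (v, z) \<in> Z \<and> t d v = t d x"
        if "(x, y) \<in> Z" "z \<in> V" "t d y = t d z" for x y z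
      proof -
        have V: "x \<in> V" "y \<in> V" and Sxy: "S c x y" and Y: "t c x \<in> Y" "t c y \<in> Y"
          using that(1) unfolding Z_def by auto
        have "S d x y" using S_mono[OF c d(1) V cd Sxy] .
        from t_iso[OF d(1) V that(2,3) this] obtain v where
          v: "v \<in> V" "t d v = t d x" and vS: "\<forall>e\<in>U. le e d \<and> S e x y \<longrightarrow> S e v z" by blast
        have "S c v z" using vS c cd Sxy by blast
        moreover have "t c v = t c x" using t_mono[OF d(1) c v(1) V(1) cd v(2)] .
        moreover have "t c y = t c z" using t_mono[OF d(1) c V(2) that(2) cd that(3)] .
        ultimately have "(v, z) \<in> Z" using v(1) Y that(2) unfolding Z_def by auto
        then show ?thesis using v by blast
      qed
      show "case xy of (x, y) \<Rightarrow> \<forall>z\<in>V. t d y = t d z \<longrightarrow> (\<exists>v. (v, z) \<in> Q' \<and> t d v = t d x)"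
      proof (clarify)
        fix x y z assume "xy = (x, y)" and z: "z \<in> V" "t d y = t d z"
        then have "(x, y) \<in> Q'" using xy by simp
        from Q'E[OF this] show "\<exists>v. (v, z) \<in> Q' \<and> t d v = t d x"
        proof (elim disjE exE conjE)
          assume "(x, y) \<in> Q"
          from Qd[OF this z] show ?thesis using Q'I(1) by blast
        next
          fix w assume w: "(x, w) \<in> Z" "w = y"
          then have "(x, y) \<in> Z" by simp
          from Zd[OF this z] show ?thesis using Q'I(2) by blast
        next
          fix w assume w: "(x, w) \<in> Z" "(w, y) \<in> Q"
          then obtain u where u: "(u, z) \<in> Q" "t d u = t d w" using Qd[OF w(2) z] by blast
          then obtain v where "(v, u) \<in> Z" "t d v = t d x" using Zd[OF w(1), of u] QV u by auto
          then show ?thesis using u(1) Q'I(3) by blast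
        qed
      qed
    qed
  qed
  then show ?thesis by blast
qed

text \<open>Insertion needs a level above all earlier ones, so the induction removes a triple of
  largest level.\<close>

lemma good_tree_exists:
  assumes "finite W" "W \<subseteq> U \<times> U \<times> U"
  shows "\<exists>n Q. good_tree W n Q"
  using assms
proof (induction "card W" arbitrary: W)
  case 0
  then have "W = {}" by simp
  then have "good_tree W 0 {}" by (simp add: good_tree_def)
  then show ?case by blast
next
  case (Suc k)
  then have W: "W \<noteq> {}" by auto
  have fin: "finite W" and sub: "W \<subseteq> U \<times> U \<times> U" by fact+
  have "\<exists>m\<in>W. \<forall>w\<in>W. le (fst w) (fst m)"
  proof (rule finite_total_max[OF fin W sub])
    fix v w assume "v \<in> U \<times> U \<times> U" "w \<in> U \<times> U \<times> U"
    then have vw: "fst v \<in> U" "fst w \<in> U" by auto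
    show "le (fst v) (fst w) \<or> le (fst w) (fst v)" by (rule le_total[OF vw])
    fix x assume "x \<in> U \<times> U \<times> U" "le (fst v) (fst w)" "le (fst w) (fst x)"
    then show "le (fst v) (fst x)" using le_trans[OF vw, of "fst x"] by auto
  qed
  then obtain m where m: "m \<in> W" "\<And>w. w \<in> W \<Longrightarrow> le (fst w) (fst m)" by blast
  obtain c p q where cpq: "m = (c, p, q)" by (cases m)
  have "k = card (W - {m})" using Suc.hyps(2) m(1) fin by simp
  then have "\<exists>n Q. good_tree (W - {m}) n Q"
    using fin sub by (intro Suc.hyps(1)) auto
  then obtain n Q where "good_tree (W - {m}) n Q" by blast
  moreover have "c \<in> U" using m(1) cpq sub by auto
  ultimately have "\<exists>n Q. good_tree (insert (c, p, q) (W - {m})) n Q"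
    using m(2) cpq sub by (intro good_tree_insert[where W = "W - {m}"]) auto
  moreover have "insert (c, p, q) (W - {m}) = W" using m cpq by auto
  ultimately show ?case by simp
qed

end

section \<open>Transfer to \<open>\<lambda>\<^sup>+\<close>\<close>

abbreviation Imp :: "('f, 'r) fm \<Rightarrow> ('f, 'r) fm \<Rightarrow> ('f, 'r) fm" (infixr "\<^bold>\<longrightarrow>" 25) where
  "Imp \<phi> \<psi> \<equiv> Neg (Conj \<phi> (Neg \<psi>))"

abbreviation Disj :: "('f, 'r) fm \<Rightarrow> ('f, 'r) fm \<Rightarrow> ('f, 'r) fm" (infixr "\<^bold>\<or>" 30) where
  "Disj \<phi> \<psi> \<equiv> Neg (Conj (Neg \<phi>) (Neg \<psi>))"

abbreviation Forall :: "nat list \<Rightarrow> ('f, 'r) fm \<Rightarrow> ('f, 'r) fm" where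
  "Forall ns \<phi> \<equiv> foldr (\<lambda>n \<psi>. Neg (Exists n (Neg \<psi>))) ns \<phi>"

abbreviation U_fm :: "nat tm \<Rightarrow> (nat, nat) fm" where
  "U_fm c \<equiv> Rel 0 [c]"

abbreviation le_fm :: "nat \<Rightarrow> nat \<Rightarrow> (nat, nat) fm" where
  "le_fm c d \<equiv> Rel 1 [Var c, Var d]"

abbreviation S_fm :: "nat \<Rightarrow> nat \<Rightarrow> nat \<Rightarrow> (nat, nat) fm" where
  "S_fm c x y \<equiv> Rel 2 [Var c, Var x, Var y]"

abbreviation t_tm :: "nat \<Rightarrow> nat \<Rightarrow> nat tm" where
  "t_tm c x \<equiv> App 0 [Var c, Var x]"

text \<open>Relation symbols 0, 1, 2 stand for \<open>U\<close>, \<open>le\<close>,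
  \<open>S\<close>, whose arities \<open>Suc\<close> produces; function symbol 0 stands for
  \<open>t\<close>.\<close>

definition tree_vocabulary :: "(nat, nat) vocabulary" where
  "tree_vocabulary = \<lparr>funs = {0}, rels = {0, 1, 2}, fun_arity = (\<lambda>_. 2), rel_arity = Suc\<rparr>"

text \<open>The order is that of the locale assumptions, so that \<open>sat_tree_axioms\<close> can
  match them conjunct by conjunct. \<open>U_sub\<close> corresponds to no axiom: it holds for
  \<open>unary_interp\<close> by definition.\<close>

definition tree_axioms :: "(nat, nat) fm list" where
  "tree_axioms =
   [Forall [0, 1] (U_fm (t_tm 0 1)),
    Forall [0, 1] (U_fm (Var 0) \<^bold>\<longrightarrow> U_fm (Var 1) \<^bold>\<longrightarrow> le_fm 0 1 \<^bold>\<or> le_fm 1 0),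
    Forall [0, 1, 2] (U_fm (Var 0) \<^bold>\<longrightarrow> U_fm (Var 1) \<^bold>\<longrightarrow> U_fm (Var 2) \<^bold>\<longrightarrow>
      le_fm 0 1 \<^bold>\<longrightarrow> le_fm 1 2 \<^bold>\<longrightarrow> le_fm 0 2),
    Forall [0, 1, 2, 3] (U_fm (Var 0) \<^bold>\<longrightarrow> U_fm (Var 1) \<^bold>\<longrightarrow> le_fm 0 1 \<^bold>\<longrightarrow> S_fm 0 2 3 \<^bold>\<longrightarrow> S_fm 1 2 3),
    Forall [0, 1, 2, 3] (U_fm (Var 0) \<^bold>\<longrightarrow> S_fm 0 1 2 \<^bold>\<longrightarrow> S_fm 0 2 3 \<^bold>\<longrightarrow> S_fm 0 1 3),
    Forall [0, 1, 2, 3] (U_fm (Var 0) \<^bold>\<longrightarrow> S_fm 0 1 3 \<^bold>\<longrightarrow> S_fm 0 2 3 \<^bold>\<longrightarrow>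
      Equal (Var 1) (Var 2) \<^bold>\<or> S_fm 0 1 2 \<^bold>\<or> S_fm 0 2 1),
    Forall [1, 2] (Equal (Var 1) (Var 2) \<^bold>\<or>
      Exists 0 (Conj (U_fm (Var 0)) (S_fm 0 1 2 \<^bold>\<or> S_fm 0 2 1))),
    Forall [0, 1, 2] (U_fm (Var 0) \<^bold>\<longrightarrow> S_fm 0 1 2 \<^bold>\<longrightarrow> Neg (Equal (t_tm 0 1) (t_tm 0 2))),
    Forall [0, 1, 2, 3] (U_fm (Var 0) \<^bold>\<longrightarrow> U_fm (Var 1) \<^bold>\<longrightarrow> le_fm 1 0 \<^bold>\<longrightarrow>
      Equal (t_tm 0 2) (t_tm 0 3) \<^bold>\<longrightarrow> Equal (t_tm 1 2) (t_tm 1 3)),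
    Forall [0, 1, 2, 3] (U_fm (Var 0) \<^bold>\<longrightarrow> Equal (t_tm 0 2) (t_tm 0 3) \<^bold>\<longrightarrow> S_fm 0 1 2 \<^bold>\<longrightarrow>
      Exists 4 (Conj (S_fm 0 4 3) (Conj (Equal (t_tm 0 4) (t_tm 0 1))
        (Forall [5] (U_fm (Var 5) \<^bold>\<longrightarrow> le_fm 5 0 \<^bold>\<longrightarrow> S_fm 5 1 2 \<^bold>\<longrightarrow> S_fm 5 4 3)))))]"

lemma tree_axioms_sentences: "set tree_axioms \<subseteq> sentences tree_vocabulary"
  by (auto simp: tree_axioms_def sentences_def tree_vocabulary_def)

text \<open>\<open>e\<close> is arbitrary because the axioms are sentences. Closure under
  \<open>fun_interp\<close> is assumed since membership in \<open>unary_interp\<close> includes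
  membership in the universe.\<close>

lemma sat_tree_axioms:
  assumes "\<And>c x. \<lbrakk>c \<in> universe B; x \<in> universe B\<rbrakk> \<Longrightarrow> fun_interp B 0 [c, x] \<in> universe B"
  shows "(\<forall>\<phi>\<in>set tree_axioms. sat B e \<phi>) \<longleftrightarrow>
    tree_system (universe B) (unary_interp B 0) (\<lambda>c d. rel_interp B 1 [c, d])
      (\<lambda>c x y. rel_interp B 2 [c, x, y]) (\<lambda>c x. fun_interp B 0 [c, x])"
proof -
  have U: "c \<in> unary_interp B 0 \<longleftrightarrow> c \<in> universe B \<and> rel_interp B 0 [c]" for c
    by (simp add: unary_interp_def)
  have sub: "unary_interp B 0 \<subseteq> universe B" by (auto simp: unary_interp_def)
  show ?thesis
    unfolding tree_system_def tree_axioms_def list.set ball_simps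
    by (simp only: sub simp_thms conj_assoc, intro arg_cong2[where f = "(\<and>)"])
      (simp add: U assms Ball_def Bex_def; safe; meson)+
qed

definition tree_structure ::
  "'v set \<Rightarrow> 'v set \<Rightarrow> ('v \<Rightarrow> 'v \<Rightarrow> bool) \<Rightarrow> ('v \<Rightarrow> 'v \<Rightarrow> 'v \<Rightarrow> bool) \<Rightarrow> ('v \<Rightarrow> 'v \<Rightarrow> 'v) \<Rightarrow>
   (nat, nat, 'v) fo_structure" where
  "tree_structure V U le S t =
    \<lparr>universe = V,
     fun_interp = (\<lambda>F xs. t (xs ! 0) (xs ! 1)),
     rel_interp = (\<lambda>R xs. if R = 0 then xs ! 0 \<in> U else if R = 1 then le (xs ! 0) (xs ! 1)
       else S (xs ! 0) (xs ! 1) (xs ! 2))\<rparr>"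

lemma tree_structure_model:
  assumes "tree_system V U le S t" "V \<noteq> {}"
  shows "is_model tree_vocabulary (set tree_axioms) (tree_structure V U le S t)"
    and "unary_interp (tree_structure V U le S t) 0 = U"
proof -
  interpret tree_system V U le S t by fact
  let ?B = "tree_structure V U le S t"
  show U: "unary_interp ?B 0 = U" using U_sub by (auto simp: unary_interp_def tree_structure_def)
  have fn: "fun_interp ?B 0 [c, x] \<in> universe ?B" if "c \<in> universe ?B" "x \<in> universe ?B" for c x
    using that t_in U_sub by (auto simp: tree_structure_def)
  have "tree_system (universe ?B) (unary_interp ?B 0) (\<lambda>c d. rel_interp ?B 1 [c, d])
      (\<lambda>c x y. rel_interp ?B 2 [c, x, y]) (\<lambda>c x. fun_interp ?B 0 [c, x])"
    using assms(1) unfolding U by (simp add: tree_structure_def)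
  then have "\<forall>\<phi>\<in>set tree_axioms. sat ?B e \<phi>" for e
    using sat_tree_axioms[of ?B e, OF fn] by blast
  then have "\<forall>\<phi>\<in>set tree_axioms. holds ?B \<phi>" by (simp add: holds_def)
  moreover have "is_structure tree_vocabulary ?B"
    unfolding is_structure_def
  proof (intro conjI ballI impI)
    show "universe ?B \<noteq> {}" using assms by (simp add: tree_structure_def)
    fix f xs assume "f \<in> funs tree_vocabulary" "xs \<in> lists (universe ?B)" "length xs = fun_arity tree_vocabulary f"
    then show "fun_interp ?B f xs \<in> universe ?B"
      using t_in U_sub by (auto simp: tree_structure_def tree_vocabulary_def length_Suc_conv numeral_2_eq_2)
  qed
  ultimately show "is_model tree_vocabulary (set tree_axioms) ?B" by (simp add: is_model_def)
qed

lemma tree_axioms_model_tree_system: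
  assumes "is_model tree_vocabulary (set tree_axioms) B"
  shows "tree_system (universe B) (unary_interp B 0) (\<lambda>c d. rel_interp B 1 [c, d])
      (\<lambda>c x y. rel_interp B 2 [c, x, y]) (\<lambda>c x. fun_interp B 0 [c, x])"
proof -
  have B: "is_structure tree_vocabulary B" "\<forall>\<phi>\<in>set tree_axioms. holds B \<phi>"
    using assms by (auto simp: is_model_def)
  obtain v where "v \<in> universe B" using B by (auto simp: is_structure_def)
  then have "\<forall>\<phi>\<in>set tree_axioms. sat B (\<lambda>_. v) \<phi>" using B by (auto simp: holds_def)
  moreover have "fun_interp B 0 [c, x] \<in> universe B" if "c \<in> universe B" "x \<in> universe B" for c x
  proof -
    have "[c, x] \<in> lists (universe B)" "length [c, x] = fun_arity tree_vocabulary 0" "0 \<in> funs tree_vocabulary"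
      using that by (auto simp: tree_vocabulary_def)
    then show ?thesis using B(1) unfolding is_structure_def by blast
  qed
  ultimately show ?thesis using sat_tree_axioms[of B "\<lambda>_. v"] by blast
qed

text \<open>The axioms hold in the structure on \<open>cardSuc natLeq\<close>, with the countable
  set \<open>range j\<close> as \<open>U\<close>. Well-foundedness and finiteness of branches are
  not first-order and are not claimed for the result.\<close>

lemma tree_system_of_transfer:
  fixes lam :: "'l rel"
  assumes "two_cardinal_transfer natLeq lam"
  shows "\<exists>(V :: 'l set set) U le S t. tree_system V U le S t \<and> |V| =o cardSuc lam \<and> |U| =o lam"
proof -
  let ?r = "cardSuc natLeq"
  have co: "Card_order ?r" by (rule cardSuc_Card_order[OF natLeq_Card_order])
  then have wo: "Well_order ?r" by (simp add: card_order_on_def)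
  have cnt: "countable (underS ?r z)" for z
  proof (cases "z \<in> Field ?r")
    case True
    then have "|underS ?r z| <o ?r" using card_of_underS[OF co] by blast
    then have "|underS ?r z| \<le>o natLeq"
      using cardSuc_ordLeq_ordLess[OF natLeq_Card_order card_of_Card_order] by blast
    then show ?thesis unfolding countable_card_le_natLeq .
  next
    case False
    then have "underS ?r z = {}" by (auto simp: underS_def Field_def)
    then show ?thesis by simp
  qed
  have "infinite (Field ?r)"
    using cardSuc_finite[OF natLeq_Card_order] by (simp add: Field_natLeq)
  then obtain j :: "nat \<Rightarrow> nat set" where j: "inj j" "range j \<subseteq> Field ?r"
    using infinite_countable_subset by blast
  obtain le S t where ts: "tree_system (Field ?r) (range j) le S t"
    using tree_system_exists[OF wo cnt j] by blast
  let ?A = "tree_structure (Field ?r) (range j) le S t"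
  have "Field ?r \<noteq> {}" using j by blast
  note A = tree_structure_model[OF ts this]
  have "|universe ?A| =o ?r"
    using card_of_Field_ordIso[OF co] by (simp add: tree_structure_def)
  moreover have "|unary_interp ?A 0| =o natLeq"
  proof -
    have "|range j| =o |UNIV :: nat set|"
      using j(1) by (metis card_of_ordIsoI inj_on_imp_bij_betw ordIso_symmetric)
    then show ?thesis using A(2) card_of_nat ordIso_transitive by metis
  qed
  moreover have "countable (symbols tree_vocabulary) \<and> 0 \<in> rels tree_vocabulary \<and> rel_arity tree_vocabulary 0 = 1"
    by (auto simp: tree_vocabulary_def intro: countable_finite)
  ultimately obtain B :: "(nat, nat, 'l set) fo_structure" where
    "is_model tree_vocabulary (set tree_axioms) B" "|universe B| =o cardSuc lam" "|unary_interp B 0| =o lam"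
    using assms tree_axioms_sentences A(1) unfolding two_cardinal_transfer_def by meson
  then show ?thesis using tree_axioms_model_tree_system by blast
qed

section \<open>Sizes in the transferred system, and the finite sets of rounds\<close>

context tree_system
begin

text \<open>Both relations are raised to the larger of the two levels; there \<open>S_trans\<close>
  yields a loop, which \<open>t_neq\<close> excludes.\<close>

lemma S_asym:
  assumes "c \<in> U" "d \<in> U" "x \<in> V" "y \<in> V" "S c x y" "S d y x"
  shows False
proof -
  have "\<exists>e\<in>U. S e x y \<and> S e y x"
    using le_total[of c d] S_mono[of c d x y] S_mono[of d c y x] assms by blast
  then obtain e where "e \<in> U" "S e x y" "S e y x" by blast
  then show False using S_trans[of e x y x] t_neq[of e x x] assms by blast
qed

text \<open>Points on one branch have distinct types in \<open>U\<close>, so each branch has at most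
  \<open>|U|\<close> points, and there is one branch below \<open>v\<close> for each element of
  \<open>U\<close>.\<close>

lemma card_below:
  assumes "Cinfinite r" "|U| \<le>o r" "v \<in> V"
  shows "|{w \<in> V. w = v \<or> (\<exists>c\<in>U. S c w v)}| \<le>o r"
proof -
  have inf: "infinite (Field r)" "Card_order r" using assms(1) by (auto simp: cinfinite_def)
  have "|{w \<in> V. S c w v}| \<le>o r" if c: "c \<in> U" for c
  proof -
    have "inj_on (t c) {w \<in> V. S c w v}"
    proof (rule inj_onI, rule ccontr)
      fix x y assume "x \<in> {w \<in> V. S c w v}" "y \<in> {w \<in> V. S c w v}" "t c x = t c y" "x \<noteq> y"
      then show False
        using S_tree[OF c, of x y v] t_neq[OF c, of x y] t_neq[OF c, of y x] assms(3) by auto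
    qed
    moreover have "t c ` {w \<in> V. S c w v} \<subseteq> U" using t_in c U_sub by auto
    ultimately have "|{w \<in> V. S c w v}| \<le>o |U|" using card_of_ordLeq by blast
    then show ?thesis using assms(2) ordLeq_transitive by blast
  qed
  then have "|\<Union>c\<in>U. {w \<in> V. S c w v}| \<le>o r"
    by (intro card_of_UNION_ordLeq_infinite_Field[OF inf assms(2)]) blast
  moreover have "|{v}| \<le>o r"
  proof (rule card_of_singl_ordLeq[THEN ordLeq_ordIso_trans])
    show "Field r \<noteq> {}" using inf by auto
    show "|Field r| =o r" using inf(2) by (rule card_of_Field_ordIso)
  qed
  ultimately have "|{v} \<union> (\<Union>c\<in>U. {w \<in> V. S c w v})| \<le>o r"
    by (intro card_of_Un_ordLeq_infinite_Field[OF inf(1) _ _ inf(2)])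
  moreover have "{w \<in> V. w = v \<or> (\<exists>c\<in>U. S c w v)} \<subseteq> {v} \<union> (\<Union>c\<in>U. {w \<in> V. S c w v})" by blast
  ultimately show ?thesis using card_of_mono1 ordLeq_transitive by blast
qed

text \<open>The transferred order need not be well-founded, so a well-ordered sequence is chosen
  inside it. At most \<open>lam\<close> lower sets of size at most \<open>lam\<close> cannot cover
  \<open>V\<close>; a point outside those of the earlier members is above all of them by
  \<open>S_total\<close>.\<close>

lemma increasing_sequence:
  fixes lam :: "'l rel"
  assumes lam: "Cinfinite lam" and V: "|V| =o cardSuc lam" and U: "|U| \<le>o lam"
  shows "\<exists>x. \<forall>z. x z \<in> V \<and> (\<forall>y\<in>underS (cardSuc lam) z. \<exists>c\<in>U. S c (x y) (x z))"
proof -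
  let ?r = "cardSuc lam"
  have inf: "infinite (Field lam)" and co: "Card_order lam"
    using lam by (auto simp: cinfinite_def)
  have cor: "Card_order ?r" by (rule cardSuc_Card_order[OF co])
  then have "wf (?r - Id)" by (simp add: card_order_on_def well_order_on_def)
  then show ?thesis
  proof (rule dependent_wf_choice)
    fix f g :: "'l set \<Rightarrow> 'v" and z v
    assume "\<And>y. (y, z) \<in> ?r - Id \<Longrightarrow> f y = g y"
    then have "\<And>y. y \<in> underS ?r z \<Longrightarrow> f y = g y" by (auto simp: underS_def)
    then show "(v \<in> V \<and> (\<forall>y\<in>underS ?r z. \<exists>c\<in>U. S c (f y) v)) =
               (v \<in> V \<and> (\<forall>y\<in>underS ?r z. \<exists>c\<in>U. S c (g y) v))" by simp
  next
    fix z f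
    assume f: "\<And>y. (y, z) \<in> ?r - Id \<Longrightarrow> f y \<in> V \<and> (\<forall>w\<in>underS ?r y. \<exists>c\<in>U. S c (f w) (f y))"
    have fV: "f y \<in> V" if "y \<in> underS ?r z" for y using f[of y] that by (auto simp: underS_def)
    let ?P = "\<Union>y\<in>underS ?r z. {w \<in> V. w = f y \<or> (\<exists>c\<in>U. S c w (f y))}"
    have "|underS ?r z| \<le>o lam"
    proof (cases "z \<in> Field ?r")
      case True
      then have "|underS ?r z| <o ?r" using card_of_underS[OF cor] by blast
      then show ?thesis using cardSuc_ordLeq_ordLess[OF co card_of_Card_order] by blast
    next
      case False
      then have "underS ?r z = {}" by (auto simp: underS_def Field_def)
      then show ?thesis using co by (simp add: card_of_empty1)
    qed
    then have "|?P| \<le>o lam"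
      by (intro card_of_UNION_ordLeq_infinite_Field[OF inf co])
        (use card_below[OF lam U] fV in blast)+
    moreover have "\<not> |V| \<le>o lam"
      using V cardSuc_greater[OF co] by (meson not_ordLess_ordLeq ordLess_ordIso_trans ordIso_symmetric)
    ultimately have "\<not> V \<subseteq> ?P" using card_of_mono1 ordLeq_transitive by blast
    then obtain v where v: "v \<in> V" "v \<notin> ?P" by blast
    have "\<exists>c\<in>U. S c (f y) v" if "y \<in> underS ?r z" for y
      using S_total[OF fV[OF that] v(1)] v that by blast
    then show "\<exists>v. v \<in> V \<and> (\<forall>y\<in>underS ?r z. \<exists>c\<in>U. S c (f y) v)" using v by blast
  qed
qed

end

lemma finite_trees_exist:
  fixes lam :: "'l rel" and D :: "'l filter"
  assumes lam: "Cinfinite lam" and tr: "two_cardinal_transfer natLeq lam" and D: "regular_filter lam D"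
  shows "\<exists>(u :: 'l \<Rightarrow> 'l set \<Rightarrow> 'l set set) n. \<forall>i z.
    u i z \<subseteq> underS (cardSuc lam) z \<and> finite (u i z) \<and> card (u i z) \<le> n i \<and>
    (\<forall>y\<in>u i z. u i y = u i z \<inter> underS (cardSuc lam) y) \<and>
    (\<forall>y\<in>underS (cardSuc lam) z. \<forall>\<^sub>F i in D. y \<in> u i z)"
proof -
  let ?r = "cardSuc lam"
  have inf: "infinite (Field lam)" and co: "Card_order lam"
    using lam by (auto simp: cinfinite_def)
  have cor: "Card_order ?r" by (rule cardSuc_Card_order[OF co])
  then interpret wo: wo_rel ?r by (simp add: card_order_on_def wo_rel_def)
  obtain V :: "'l set set" and U le S t where
    ts: "tree_system V U le S t" and V: "|V| =o ?r" and U: "|U| =o lam"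
    using tree_system_of_transfer[OF tr] by blast
  interpret tree_system V U le S t by (rule ts)
  have Ule: "|U| \<le>o lam" using U by (rule ordIso_imp_ordLeq)
  obtain x where xV: "\<And>z. x z \<in> V" and x: "\<And>y z. y \<in> underS ?r z \<Longrightarrow> \<exists>c\<in>U. S c (x y) (x z)"
    using increasing_sequence[OF lam V Ule] by blast
  have "|U \<times> U \<times> U| \<le>o lam"
    by (intro card_of_Times_ordLeq_infinite_Field[OF inf _ _ co] Ule)
  then have "|U \<times> U \<times> U| \<le>o |Field lam|"
    using card_of_Field_ordIso[OF co] ordIso_symmetric ordLeq_ordIso_trans by blast
  then obtain q where q: "inj_on q (U \<times> U \<times> U)" "q ` (U \<times> U \<times> U) \<subseteq> Field lam"
    unfolding card_of_ordLeq[symmetric] by blast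
  obtain A where A: "\<And>a. a \<in> Field lam \<Longrightarrow> \<forall>\<^sub>F i in D. i \<in> A a"
    and Afin: "\<And>i. i \<in> Field lam \<Longrightarrow> finite {a \<in> Field lam. i \<in> A a}"
    and FD: "\<forall>\<^sub>F i in D. i \<in> Field lam"
    using D unfolding regular_filter_def filter_on_def by blast
  \<comment> \<open>\<open>q\<close> indexes the triples by \<open>lam\<close>, and \<open>i\<close>
    receives those whose member of the regular family contains \<open>i\<close>: finitely many at
    each \<open>i\<close>, and each triple at \<open>D\<close>-almost all \<open>i\<close>.\<close>
  define W where "W i = {w \<in> U \<times> U \<times> U. i \<in> Field lam \<and> i \<in> A (q w)}" for i
  have "finite (W i)" for i
  proof (cases "i \<in> Field lam")
    case True
    have "q ` W i \<subseteq> {a \<in> Field lam. i \<in> A a}" using q(2) by (auto simp: W_def)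
    then have "finite (q ` W i)" using Afin[OF True] finite_subset by blast
    moreover have "inj_on q (W i)" by (rule inj_on_subset[OF q(1)]) (auto simp: W_def)
    ultimately show ?thesis by (rule finite_imageD)
  qed (simp add: W_def)
  moreover have "W i \<subseteq> U \<times> U \<times> U" for i by (auto simp: W_def)
  ultimately have "\<exists>n Q. good_tree (W i) n Q" for i by (rule good_tree_exists)
  then obtain n Q where nQ: "\<And>i. good_tree (W i) (n i) (Q i)" by metis
  have Qtr: "trans (Q i)"
    and Qtree: "\<And>a b c. (a, c) \<in> Q i \<Longrightarrow> (b, c) \<in> Q i \<Longrightarrow> a = b \<or> (a, b) \<in> Q i \<or> (b, a) \<in> Q i"
    and Qfin: "\<And>z. finite {a. (a, z) \<in> Q i} \<and> card {a. (a, z) \<in> Q i} \<le> n i"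
    and QW: "\<And>w a b. w \<in> W i \<Longrightarrow> a \<in> V \<Longrightarrow> b \<in> V \<Longrightarrow> fits w a b \<Longrightarrow> (a, b) \<in> Q i"
    and QS: "\<And>a b. (a, b) \<in> Q i \<Longrightarrow> \<exists>w\<in>W i. S (fst w) a b" for i
    using nQ[of i] unfolding good_tree_def by (simp_all split: prod.splits) blast+
  \<comment> \<open>The tree \<open>Q i\<close> pulled back along \<open>x\<close>, from points of
    the system to rounds.\<close>
  define u where "u i z = {y \<in> underS ?r z. (x y, x z) \<in> Q i}" for i z
  have xne: "x y \<noteq> x z" if "y \<in> underS ?r z" for y z
    using x[OF that] t_neq[OF _ xV xV] by metis
  have tot: "y \<in> underS ?r z \<or> z \<in> underS ?r y" if "y \<noteq> z" "y \<in> Field ?r" "z \<in> Field ?r" for y z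
    using that wo.TOTALS unfolding underS_def by blast
  have FieldU: "y \<in> Field ?r" if "y \<in> underS ?r z" for y z
    using that by (auto simp: underS_def Field_def)
  have Ustrans: "w \<in> underS ?r z" if "w \<in> underS ?r y" "y \<in> underS ?r z" for w y z
    using that wo.TRANS wo.ANTISYM unfolding underS_def trans_def antisym_def by blast
  have "u i z \<subseteq> underS ?r z" for i z by (auto simp: u_def)
  moreover have "finite (u i z) \<and> card (u i z) \<le> n i" for i z
  proof -
    have inj: "inj_on x (u i z)"
    proof (rule inj_onI, rule ccontr)
      fix a b assume ab: "a \<in> u i z" "b \<in> u i z" "x a = x b" "a \<noteq> b"
      then have "a \<in> underS ?r b \<or> b \<in> underS ?r a"
        using tot FieldU unfolding u_def by blast
      then show False using xne[of a b] xne[of b a] ab(3) by auto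
    qed
    have im: "x ` u i z \<subseteq> {a. (a, x z) \<in> Q i}" by (auto simp: u_def)
    have "finite {a. (a, x z) \<in> Q i}" "card {a. (a, x z) \<in> Q i} \<le> n i" using Qfin by blast+
    then show ?thesis using inj_on_finite[OF inj im] card_inj_on_le[OF inj im] by linarith
  qed
  moreover have "u i y = u i z \<inter> underS ?r y" if y: "y \<in> u i z" for i y z
  proof
    show "u i y \<subseteq> u i z \<inter> underS ?r y"
    proof
      fix w assume w: "w \<in> u i y"
      have "(x w, x z) \<in> Q i" using w y by (auto simp: u_def intro: transD[OF Qtr])
      then show "w \<in> u i z \<inter> underS ?r y" using w y Ustrans[of w y z] by (auto simp: u_def)
    qed
    show "u i z \<inter> underS ?r y \<subseteq> u i y"
    proof
      fix w assume w: "w \<in> u i z \<inter> underS ?r y"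
      then have "x w = x y \<or> (x w, x y) \<in> Q i \<or> (x y, x w) \<in> Q i"
        using y by (intro Qtree[of _ "x z"]) (auto simp: u_def)
      moreover have "x w \<noteq> x y" using w xne by blast
      \<comment> \<open>\<open>Q i\<close> cannot run against the order of rounds: its pairs lie in
        trees of the system, and by \<open>S_asym\<close> no two trees order a pair
        oppositely.\<close>
      moreover have "(x y, x w) \<notin> Q i"
      proof
        assume "(x y, x w) \<in> Q i"
        then obtain v where "v \<in> W i" "S (fst v) (x y) (x w)" using QS by blast
        moreover from this have "fst v \<in> U" by (auto simp: W_def)
        moreover obtain c where "c \<in> U" "S c (x w) (x y)" using x w by blast
        ultimately show False using S_asym xV by blast
      qed
      ultimately show "w \<in> u i y" using w by (auto simp: u_def)
    qed
  qed
  moreover have "\<forall>\<^sub>F i in D. y \<in> u i z" if yz: "y \<in> underS ?r z" for y z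
  proof -
    obtain c where c: "c \<in> U" "S c (x y) (x z)" using x[OF yz] by blast
    \<comment> \<open>This triple forces \<open>x y\<close> below \<open>x z\<close> in
      \<open>Q i\<close> at every \<open>i\<close> that receives it.\<close>
    let ?w = "(c, t c (x y), t c (x z))"
    have w: "?w \<in> U \<times> U \<times> U" using c t_in xV U_sub by auto
    then have "q ?w \<in> Field lam" using q(2) by blast
    from A[OF this] FD show ?thesis
    proof eventually_elim
      case (elim i)
      then have "?w \<in> W i" using w by (simp add: W_def)
      then have "(x y, x z) \<in> Q i" by (rule QW) (use c xV in \<open>auto simp: fits_def\<close>)
      then show ?case using yz by (simp add: u_def)
    qed
  qed
  ultimately have "\<forall>i z. u i z \<subseteq> underS ?r z \<and> finite (u i z) \<and> card (u i z) \<le> n i \<and>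
    (\<forall>y\<in>u i z. u i y = u i z \<inter> underS ?r y) \<and> (\<forall>y\<in>underS ?r z. \<forall>\<^sub>F i in D. y \<in> u i z)"
    by blast
  then show ?thesis by blast
qed

section \<open>Back-and-forth in finite vocabularies\<close>

text \<open>The game with \<open>k\<close> moves left from position \<open>\<pi>\<close>. Only final
  positions are tested, since partial isomorphisms restrict to subsets.\<close>

primrec back_and_forth ::
  "nat \<Rightarrow> ('f, 'r) vocabulary \<Rightarrow> ('f, 'r, 'a) fo_structure \<Rightarrow> ('f, 'r, 'b) fo_structure \<Rightarrow>
   ('a \<times> 'b) set \<Rightarrow> bool" where
  "back_and_forth 0 L M N \<pi> \<longleftrightarrow> partial_isomorphism L M N \<pi>"
| "back_and_forth (Suc k) L M N \<pi> \<longleftrightarrow>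
     (\<forall>a\<in>universe M. \<exists>b\<in>universe N. back_and_forth k L M N (insert (a, b) \<pi>)) \<and>
     (\<forall>b\<in>universe N. \<exists>a\<in>universe M. back_and_forth k L M N (insert (a, b) \<pi>))"

lemma partial_isomorphism_eq_iff:
  assumes "partial_isomorphism L M N \<pi>" "p \<in> \<pi>" "q \<in> \<pi>"
  shows "fst p = fst q \<longleftrightarrow> snd p = snd q"
proof -
  have "\<forall>(a, b)\<in>\<pi>. \<forall>(a', b')\<in>\<pi>. a = a' \<longleftrightarrow> b = b'"
    using assms(1) unfolding partial_isomorphism_def by (elim conjE)
  then show ?thesis using assms(2,3) by (simp add: case_prod_beta)
qed

lemma partial_isomorphism_rel:
  assumes "partial_isomorphism L M N \<pi>" "R \<in> rels L" "ps \<in> lists \<pi>" "length ps = rel_arity L R"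
  shows "rel_interp M R (map fst ps) \<longleftrightarrow> rel_interp N R (map snd ps)"
  using assms unfolding partial_isomorphism_def by blast

lemma partial_isomorphism_subset:
  assumes "partial_isomorphism L M N \<pi>" "\<pi>' \<subseteq> \<pi>"
  shows "partial_isomorphism L M N \<pi>'"
proof -
  have "lists \<pi>' \<subseteq> lists \<pi>" using assms(2) by (rule lists_mono)
  then have "\<forall>R\<in>rels L. \<forall>ps\<in>lists \<pi>'. length ps = rel_arity L R \<longrightarrow>
      (rel_interp M R (map fst ps) \<longleftrightarrow> rel_interp N R (map snd ps))"
    using assms(1) unfolding partial_isomorphism_def by (meson subsetD)
  moreover have "\<pi>' \<subseteq> universe M \<times> universe N"
    using assms unfolding partial_isomorphism_def by (meson order_trans)
  moreover have "\<forall>p\<in>\<pi>'. \<forall>q\<in>\<pi>'. fst p = fst q \<longleftrightarrow> snd p = snd q"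
  proof (intro ballI)
    fix p q assume "p \<in> \<pi>'" "q \<in> \<pi>'"
    then have "p \<in> \<pi>" "q \<in> \<pi>" using assms(2) by auto
    then show "fst p = fst q \<longleftrightarrow> snd p = snd q" by (rule partial_isomorphism_eq_iff[OF assms(1)])
  qed
  then have "\<forall>(a, b)\<in>\<pi>'. \<forall>(a', b')\<in>\<pi>'. a = a' \<longleftrightarrow> b = b'"
    by (simp add: case_prod_beta)
  ultimately show ?thesis unfolding partial_isomorphism_def by blast
qed

text \<open>The remaining moves are played with arbitrary elements, whence the nonempty universe,
  and the outcome is restricted to \<open>\<pi>\<close>.\<close>

lemma back_and_forth_partial_isomorphism:
  assumes "back_and_forth k L M N \<pi>" "universe M \<noteq> {}"
  shows "partial_isomorphism L M N \<pi>"
  using assms(1)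
proof (induction k arbitrary: \<pi>)
  case (Suc k)
  obtain a where "a \<in> universe M" using assms(2) by blast
  then obtain b where "back_and_forth k L M N (insert (a, b) \<pi>)" using Suc.prems by auto
  then have "partial_isomorphism L M N (insert (a, b) \<pi>)" by (rule Suc.IH)
  then show ?case by (rule partial_isomorphism_subset) blast
qed simp

section \<open>Finitely many formulas that decide the game\<close>

lemma tm_val_cong: "(\<And>i. i \<in> tm_vars s \<Longrightarrow> e i = e' i) \<Longrightarrow> tm_val M e s = tm_val M e' s"
proof (induction s)
  case (App f ts)
  then have "map (tm_val M e) ts = map (tm_val M e') ts"
    by (intro map_cong refl App.IH App.prems) auto
  then show ?case by (simp only: tm_val.simps)
qed simp

lemma sat_cong: "(\<And>i. i \<in> free_vars \<phi> \<Longrightarrow> e i = e' i) \<Longrightarrow> sat M e \<phi> \<longleftrightarrow> sat M e' \<phi>"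
proof (induction \<phi> arbitrary: e e')
  case (Equal s t)
  have "tm_val M e s = tm_val M e' s" "tm_val M e t = tm_val M e' t"
    by (intro tm_val_cong Equal.prems; simp)+
  then show ?case by simp
next
  case (Rel R ts)
  then have "map (tm_val M e) ts = map (tm_val M e') ts"
    by (intro map_cong refl tm_val_cong Rel.prems) auto
  then show ?case by (simp del: map_eq_conv)
next
  case (Neg \<phi>)
  have "sat M e \<phi> \<longleftrightarrow> sat M e' \<phi>" by (rule Neg.IH) (simp add: Neg.prems)
  then show ?case by simp
next
  case (Conj \<phi> \<psi>)
  have "sat M e \<phi> \<longleftrightarrow> sat M e' \<phi>" by (rule Conj.IH) (simp add: Conj.prems)
  moreover have "sat M e \<psi> \<longleftrightarrow> sat M e' \<psi>" by (rule Conj.IH) (simp add: Conj.prems)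
  ultimately show ?case by simp
next
  case (Exists n \<phi>)
  have "sat M (e(n := a)) \<phi> \<longleftrightarrow> sat M (e'(n := a)) \<phi>" for a
    by (rule Exists.IH) (simp add: Exists.prems)
  then show ?case by simp
qed

lemma sat_sentence:
  assumes "free_vars \<phi> = {}" "range e \<subseteq> universe M"
  shows "sat M e \<phi> \<longleftrightarrow> holds M \<phi>"
proof -
  have "sat M e' \<phi> \<longleftrightarrow> sat M e \<phi>" for e' by (rule sat_cong) (simp add: assms(1))
  then show ?thesis using assms(2) unfolding holds_def by blast
qed

text \<open>A complete description relative to the list, as in Hintikka formulas. The empty
  conjunction is a valid equation in \<open>Var n\<close>, a variable that \<open>Exists n\<close>
  binds later.\<close>

definition state_fm :: "nat \<Rightarrow> ('f, 'r) fm list \<Rightarrow> ('f, 'r) fm set \<Rightarrow> ('f, 'r) fm" where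
  "state_fm n \<phi>s X =
     foldr (\<lambda>\<phi>. Conj (if \<phi> \<in> X then \<phi> else Neg \<phi>)) \<phi>s (Equal (Var n) (Var n))"

lemma sat_state_fm: "sat M e (state_fm n \<phi>s X) \<longleftrightarrow> (\<forall>\<phi>\<in>set \<phi>s. sat M e \<phi> \<longleftrightarrow> \<phi> \<in> X)"
  unfolding state_fm_def by (induction \<phi>s) auto

lemma is_formula_state_fm: "is_formula L (state_fm n \<phi>s X) \<longleftrightarrow> (\<forall>\<phi>\<in>set \<phi>s. is_formula L \<phi>)"
  unfolding state_fm_def by (induction \<phi>s) auto

lemma free_vars_state_fm: "free_vars (state_fm n \<phi>s X) = insert n (\<Union>\<phi>\<in>set \<phi>s. free_vars \<phi>)"
  unfolding state_fm_def by (induction \<phi>s) auto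

text \<open>\<open>\<Phi>\<close> is chosen before the structures, and for \<open>n = 0\<close> it
  consists of sentences, to which elementary equivalence applies. Each further move costs one
  quantifier over the new variable \<open>n\<close>; a finite set of formulas leaves only finitely
  many descriptions of the new element.\<close>

lemma back_and_forth_formulas:
  fixes F :: "'r set" and L :: "('f, 'r) vocabulary"
  assumes F: "finite F" "F \<subseteq> rels L"
  shows "\<exists>\<Phi> :: ('f, 'r) fm set. finite \<Phi> \<and> (\<forall>\<phi>\<in>\<Phi>. is_formula L \<phi> \<and> free_vars \<phi> \<subseteq> {..<n}) \<and>
    (\<forall>(M :: ('f, 'r, 'a) fo_structure) (N :: ('f, 'r, 'b) fo_structure) e e'.
       (\<forall>i<n. e i \<in> universe M \<and> e' i \<in> universe N) \<longrightarrow> (\<forall>\<phi>\<in>\<Phi>. sat M e \<phi> \<longleftrightarrow> sat N e' \<phi>) \<longrightarrow>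
       back_and_forth k (L\<lparr>rels := F\<rparr>) M N ((\<lambda>i. (e i, e' i)) ` {..<n}))"
proof (induction k arbitrary: n)
  case 0
  let ?R = "\<lambda>R. {is. set is \<subseteq> {..<n} \<and> length is = rel_arity L R}"
  define \<Phi> :: "('f, 'r) fm set" where "\<Phi> = (\<lambda>(i, j). Equal (Var i) (Var j)) ` ({..<n} \<times> {..<n}) \<union>
    (\<Union>R\<in>F. (\<lambda>is. Rel R (map Var is)) ` ?R R)"
  have "finite \<Phi>" unfolding \<Phi>_def using F(1) by (auto intro!: finite_lists_length_eq)
  moreover have "is_formula L \<phi> \<and> free_vars \<phi> \<subseteq> {..<n}" if "\<phi> \<in> \<Phi>" for \<phi>
    using that F(2) by (auto simp: \<Phi>_def)
  moreover have "partial_isomorphism (L\<lparr>rels := F\<rparr>) M N ((\<lambda>i. (e i, e' i)) ` {..<n})"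
    if e: "\<forall>i<n. e i \<in> universe M \<and> e' i \<in> universe N" and sat: "\<forall>\<phi>\<in>\<Phi>. sat M e \<phi> \<longleftrightarrow> sat N e' \<phi>"
    for M :: "('f, 'r, 'a) fo_structure" and N :: "('f, 'r, 'b) fo_structure" and e e'
    unfolding partial_isomorphism_def
  proof (intro conjI ballI impI)
    show "(\<lambda>i. (e i, e' i)) ` {..<n} \<subseteq> universe M \<times> universe N" using e by auto
  next
    fix p assume "p \<in> (\<lambda>i. (e i, e' i)) ` {..<n}"
    then obtain i where i: "i < n" "p = (e i, e' i)" by auto
    have "e i = e j \<longleftrightarrow> e' i = e' j" if "j < n" for j
    proof -
      have "Equal (Var i) (Var j) \<in> \<Phi>" using that i by (auto simp: \<Phi>_def)
      then have "sat M e (Equal (Var i) (Var j)) \<longleftrightarrow> sat N e' (Equal (Var i) (Var j))"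
        using sat by blast
      then show ?thesis by simp
    qed
    then show "case p of (a, b) \<Rightarrow> \<forall>(a', b')\<in>(\<lambda>i. (e i, e' i)) ` {..<n}. (a = a') = (b = b')"
      using i by auto
  next
    fix R ps assume R: "R \<in> rels (L\<lparr>rels := F\<rparr>)" and ps: "ps \<in> lists ((\<lambda>i. (e i, e' i)) ` {..<n})"
      and len: "length ps = rel_arity (L\<lparr>rels := F\<rparr>) R"
    obtain "is" where "is": "ps = map (\<lambda>i. (e i, e' i)) is" "set is \<subseteq> {..<n}"
      using ps by (auto simp: lists_image in_lists_conv_set)
    then have "Rel R (map Var is) \<in> \<Phi>" using R len by (auto simp: \<Phi>_def)
    then have "sat M e (Rel R (map Var is)) \<longleftrightarrow> sat N e' (Rel R (map Var is))" using sat by blast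
    then show "rel_interp M R (map fst ps) = rel_interp N R (map snd ps)"
      by (simp add: "is" comp_def)
  qed
  ultimately show ?case by (intro exI[of _ \<Phi>]) simp
next
  case (Suc k)
  obtain \<Phi> :: "('f, 'r) fm set" where fin: "finite \<Phi>"
    and \<Phi>: "\<forall>\<phi>\<in>\<Phi>. is_formula L \<phi> \<and> free_vars \<phi> \<subseteq> {..<Suc n}"
    and bf: "\<forall>(M :: ('f, 'r, 'a) fo_structure) (N :: ('f, 'r, 'b) fo_structure) e e'.
       (\<forall>i<Suc n. e i \<in> universe M \<and> e' i \<in> universe N) \<longrightarrow> (\<forall>\<phi>\<in>\<Phi>. sat M e \<phi> \<longleftrightarrow> sat N e' \<phi>) \<longrightarrow>
       back_and_forth k (L\<lparr>rels := F\<rparr>) M N ((\<lambda>i. (e i, e' i)) ` {..<Suc n})"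
    using Suc.IH[of "Suc n"] by (elim exE conjE) (rule that)
  obtain \<phi>s where \<phi>s: "set \<phi>s = \<Phi>" using finite_list[OF fin] by blast
  \<comment> \<open>One formula for each possible description of the next element over the previous
    stage.\<close>
  define \<Psi> where "\<Psi> = (\<lambda>X. Exists n (state_fm n \<phi>s X)) ` Pow \<Phi>"
  have "finite \<Psi>" using fin by (simp add: \<Psi>_def)
  moreover have "is_formula L \<psi> \<and> free_vars \<psi> \<subseteq> {..<n}" if \<psi>: "\<psi> \<in> \<Psi>" for \<psi>
  proof -
    obtain X where X: "\<psi> = Exists n (state_fm n \<phi>s X)" using \<psi> by (auto simp: \<Psi>_def)
    have "free_vars \<phi> - {n} \<subseteq> {..<n}" if "\<phi> \<in> \<Phi>" for \<phi>
      using \<Phi> that by (fastforce simp: less_Suc_eq)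
    then show ?thesis using X \<Phi> \<phi>s by (simp add: is_formula_state_fm free_vars_state_fm) blast
  qed
  moreover have "back_and_forth (Suc k) (L\<lparr>rels := F\<rparr>) M N ((\<lambda>i. (e i, e' i)) ` {..<n})"
    if e: "\<forall>i<n. e i \<in> universe M \<and> e' i \<in> universe N" and sat: "\<forall>\<psi>\<in>\<Psi>. sat M e \<psi> \<longleftrightarrow> sat N e' \<psi>"
    for M :: "('f, 'r, 'a) fo_structure" and N :: "('f, 'r, 'b) fo_structure" and e e'
  proof -
    have sat_ex: "(\<exists>a\<in>universe M. \<forall>\<phi>\<in>\<Phi>. sat M (e(n := a)) \<phi> \<longleftrightarrow> \<phi> \<in> X) \<longleftrightarrow>
        (\<exists>b\<in>universe N. \<forall>\<phi>\<in>\<Phi>. sat N (e'(n := b)) \<phi> \<longleftrightarrow> \<phi> \<in> X)" if "X \<subseteq> \<Phi>" for X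
    proof -
      have "Exists n (state_fm n \<phi>s X) \<in> \<Psi>" using that by (auto simp: \<Psi>_def)
      then have "sat M e (Exists n (state_fm n \<phi>s X)) \<longleftrightarrow> sat N e' (Exists n (state_fm n \<phi>s X))"
        using sat by blast
      then show ?thesis by (simp add: sat_state_fm \<phi>s)
    qed
    have step: "back_and_forth k (L\<lparr>rels := F\<rparr>) M N (insert (a, b) ((\<lambda>i. (e i, e' i)) ` {..<n}))"
      if "a \<in> universe M" "b \<in> universe N"
        "\<And>\<phi>. \<phi> \<in> \<Phi> \<Longrightarrow> sat M (e(n := a)) \<phi> \<longleftrightarrow> sat N (e'(n := b)) \<phi>" for a b
    proof -
      have "back_and_forth k (L\<lparr>rels := F\<rparr>) M N ((\<lambda>i. ((e(n := a)) i, (e'(n := b)) i)) ` {..<Suc n})"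
        using that e
        by (intro bf[rule_format, where e = "e(n := a)" and e' = "e'(n := b)"]) (auto simp: less_Suc_eq)
      moreover have "(\<lambda>i. ((e(n := a)) i, (e'(n := b)) i)) ` {..<Suc n} =
          insert (a, b) ((\<lambda>i. (e i, e' i)) ` {..<n})"
        unfolding lessThan_Suc image_insert by (intro arg_cong2[where f = insert] image_cong) auto
      ultimately show ?thesis by simp
    qed
    show ?thesis
      unfolding back_and_forth.simps
    proof (intro conjI ballI)
      fix a assume a: "a \<in> universe M"
      \<comment> \<open>The description of \<open>a\<close> is realised in \<open>M\<close>, hence
        in \<open>N\<close>; a realisation there is the answer.\<close>
      have "\<exists>b\<in>universe N. \<forall>\<phi>\<in>\<Phi>. sat N (e'(n := b)) \<phi> \<longleftrightarrow> \<phi> \<in> {\<phi>\<in>\<Phi>. sat M (e(n := a)) \<phi>}"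
        unfolding sat_ex[of "{\<phi>\<in>\<Phi>. sat M (e(n := a)) \<phi>}", OF Collect_restrict, symmetric]
        using a by (intro bexI[of _ a]) simp_all
      then show "\<exists>b\<in>universe N. back_and_forth k (L\<lparr>rels := F\<rparr>) M N (insert (a, b) ((\<lambda>i. (e i, e' i)) ` {..<n}))"
        using step[OF a] by (metis (mono_tags, lifting) mem_Collect_eq)
    next
      fix b assume b: "b \<in> universe N"
      have "\<exists>a\<in>universe M. \<forall>\<phi>\<in>\<Phi>. sat M (e(n := a)) \<phi> \<longleftrightarrow> \<phi> \<in> {\<phi>\<in>\<Phi>. sat N (e'(n := b)) \<phi>}"
        unfolding sat_ex[of "{\<phi>\<in>\<Phi>. sat N (e'(n := b)) \<phi>}", OF Collect_restrict]
        using b by (intro bexI[of _ b]) simp_all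
      then show "\<exists>a\<in>universe M. back_and_forth k (L\<lparr>rels := F\<rparr>) M N (insert (a, b) ((\<lambda>i. (e i, e' i)) ` {..<n}))"
        using step[OF _ b] by (metis (mono_tags, lifting) mem_Collect_eq)
    qed
  qed
  ultimately show ?case by (intro exI[of _ \<Psi>]) simp
qed

lemma elementarily_equivalent_back_and_forth:
  fixes M :: "('f, 'r, 'a) fo_structure" and N :: "('f, 'r, 'b) fo_structure"
  assumes F: "finite F" "F \<subseteq> rels L"
    and M: "is_structure L M" and N: "is_structure L N" and eq: "elementarily_equivalent L M N"
  shows "back_and_forth k (L\<lparr>rels := F\<rparr>) M N {}"
proof -
  obtain \<Phi> :: "('f, 'r) fm set" where \<Phi>: "\<forall>\<phi>\<in>\<Phi>. is_formula L \<phi> \<and> free_vars \<phi> \<subseteq> {..<0}"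
    and bf: "\<forall>M N e e'. (\<forall>i<0. e i \<in> universe M \<and> e' i \<in> universe N) \<longrightarrow>
       (\<forall>\<phi>\<in>\<Phi>. sat M e \<phi> \<longleftrightarrow> sat N e' \<phi>) \<longrightarrow>
       back_and_forth k (L\<lparr>rels := F\<rparr>) (M :: ('f, 'r, 'a) fo_structure) (N :: ('f, 'r, 'b) fo_structure)
         ((\<lambda>i. (e i, e' i)) ` {..<0})"
    using back_and_forth_formulas[OF F, of 0 k] by (elim exE conjE) (rule that)
  obtain a b where "a \<in> universe M" "b \<in> universe N" using M N by (auto simp: is_structure_def)
  then have sat: "sat M (\<lambda>_. a) \<phi> \<longleftrightarrow> sat N (\<lambda>_. b) \<phi>" if "\<phi> \<in> \<Phi>" for \<phi>
    using \<Phi> that eq sat_sentence[of \<phi> "\<lambda>_. a" M] sat_sentence[of \<phi> "\<lambda>_. b" N]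
    by (auto simp: elementarily_equivalent_def sentences_def)
  show ?thesis
    using bf[rule_format, of "\<lambda>_. a" M "\<lambda>_. b" N] sat by simp
qed

section \<open>The winning strategy\<close>

definition agrees :: "'a + 'b \<Rightarrow> 'a \<times> 'b \<Rightarrow> bool" where
  "agrees c p \<longleftrightarrow> (case c of Inl a \<Rightarrow> fst p = a | Inr b \<Rightarrow> snd p = b)"

lemma well_order_finite_max:
  assumes "Well_order r" "finite Z" "Z \<noteq> {}" "Z \<subseteq> Field r"
  shows "\<exists>y\<in>Z. \<forall>w\<in>Z. (w, y) \<in> r"
proof -
  interpret wo: wo_rel r using assms(1) by (simp add: wo_rel_def)
  show ?thesis
    by (rule finite_total_max[OF assms(2-4)]) (use wo.TOTALS wo.TRANS in \<open>auto simp: trans_def\<close>)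
qed

text \<open>
  \<open>p c z\<close> is the pair played in round \<open>z\<close> when \<open>c\<close> are the moves of player I; the first clause
  says that it does not depend on later moves.
\<close>

definition answers ::
  "'g rel \<Rightarrow> ('g \<Rightarrow> 'g set) \<Rightarrow> nat \<Rightarrow> 'a set \<Rightarrow> 'b set \<Rightarrow> (nat \<Rightarrow> ('a \<times> 'b) set \<Rightarrow> bool) \<Rightarrow>
   (('g \<Rightarrow> 'a + 'b) \<Rightarrow> 'g \<Rightarrow> 'a \<times> 'b) \<Rightarrow> bool" where
  "answers r u n A B BF p \<longleftrightarrow>
     (\<forall>z\<in>Field r. \<forall>c c'. (\<forall>y\<in>under r z. c y = c' y) \<longrightarrow> p c z = p c' z) \<and>
     (\<forall>c. (\<forall>z\<in>Field r. c z \<in> A <+> B) \<longrightarrow>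
       (\<forall>z\<in>Field r. p c z \<in> A \<times> B \<and> agrees (c z) (p c z) \<and>
          BF (n - card (u z)) (insert (p c z) (p c ` u z))))"

text \<open>By coherence, \<open>u z\<close> is \<open>insert y (u y)\<close> for its largest
  element \<open>y\<close>, so round \<open>z\<close> faces exactly the position left behind by
  round \<open>y\<close>. The reserve starts at \<open>Suc n\<close> because the at most
  \<open>n\<close> rounds of \<open>u z\<close> and round \<open>z\<close> itself each use one
  move.\<close>

lemma answers_exist:
  fixes r :: "'g rel" and A :: "'a set" and B :: "'b set" and BF :: "nat \<Rightarrow> ('a \<times> 'b) set \<Rightarrow> bool"
  assumes r: "Well_order r"
    and u: "\<And>z. u z \<subseteq> underS r z" "\<And>z. finite (u z)" "\<And>z. card (u z) \<le> n"
      "\<And>y z. y \<in> u z \<Longrightarrow> u y = u z \<inter> underS r y"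
    and BF0: "BF (Suc n) {}"
    and BF1: "\<And>k \<pi> a. BF (Suc k) \<pi> \<Longrightarrow> a \<in> A \<Longrightarrow> \<exists>b\<in>B. BF k (insert (a, b) \<pi>)"
    and BF2: "\<And>k \<pi> b. BF (Suc k) \<pi> \<Longrightarrow> b \<in> B \<Longrightarrow> \<exists>a\<in>A. BF k (insert (a, b) \<pi>)"
  shows "\<exists>p. answers r u n A B BF p"
proof -
  interpret wo: wo_rel r using r by (simp add: wo_rel_def)
  have wf: "wf (r - Id)" using r by (simp add: well_order_on_def)
  define ok where "ok c p z ab \<longleftrightarrow> ab \<in> A \<times> B \<and> agrees (c z) ab \<and>
    BF (n - card (u z)) (insert ab (p ` u z))" for c :: "'g \<Rightarrow> 'a + 'b" and p z ab
  \<comment> \<open>Recursion over the rounds for fixed \<open>c\<close>. The chosen pair is shown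
    to be admissible only for legal \<open>c\<close>, in \<open>ok\<close> below.\<close>
  define p where "p c = wfrec (r - Id) (\<lambda>p z. SOME ab. ok c p z ab)" for c
  have "adm_wf (r - Id) (\<lambda>p z. SOME ab. ok c p z ab)" for c
    unfolding adm_wf_def
  proof (intro allI impI)
    fix f g :: "'g \<Rightarrow> 'a \<times> 'b" and z
    assume *: "\<forall>y. (y, z) \<in> r - Id \<longrightarrow> f y = g y"
    have "f ` u z = g ` u z"
      by (rule image_cong) (use * u(1)[of z] in \<open>auto simp: underS_def\<close>)
    then show "(SOME ab. ok c f z ab) = (SOME ab. ok c g z ab)" by (simp add: ok_def)
  qed
  then have p: "p c z = (SOME ab. ok c (p c) z ab)" for c z
    unfolding p_def by (subst wfrec_fixpoint[OF wf]) simp_all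
  have causal: "p c z = p c' z"
    if "z \<in> Field r" "\<And>y. y \<in> under r z \<Longrightarrow> c y = c' y" for c c' z
    using that
  proof (induction z rule: wo.well_order_induct)
    case (1 z)
    have "p c y = p c' y" if y: "y \<in> u z" for y
    proof -
      have yz: "y \<noteq> z" "(y, z) \<in> r" using u(1)[of z] y by (auto simp: underS_def)
      moreover have "y \<in> Field r" using yz by (auto simp: Field_def)
      moreover have "under r y \<subseteq> under r z" by (rule under_incr[OF wo.TRANS yz(2)])
      ultimately show ?thesis using 1 by blast
    qed
    then have "p c ` u z = p c' ` u z" by (rule image_cong[OF refl])
    moreover have "c z = c' z" using 1 wo.REFL by (auto simp: under_def refl_on_def)
    ultimately have "ok c (p c) z = ok c' (p c') z" unfolding ok_def by simp
    then show ?case unfolding p[of c z] p[of c' z] by simp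
  qed
  have ok: "ok c (p c) z (p c z)" if c: "\<forall>z\<in>Field r. c z \<in> A <+> B" and "z \<in> Field r" for c z
    using that(2)
  proof (induction z rule: wo.well_order_induct)
    case (1 z)
    have BF: "BF (Suc (n - card (u z))) (p c ` u z)"
    proof (cases "u z = {}")
      case True
      then show ?thesis using BF0 by simp
    next
      case False
      have uF: "u z \<subseteq> Field r" using u(1)[of z] by (auto simp: underS_def Field_def)
      obtain y where y: "y \<in> u z" "\<And>w. w \<in> u z \<Longrightarrow> (w, y) \<in> r"
        using well_order_finite_max[OF r u(2) False uF] by blast
      have eq: "u z = insert y (u y)" using y u(4)[OF y(1)] by (auto simp: underS_def)
      have ny: "y \<notin> u y" using u(1)[of y] by (auto simp: underS_def)
      have "y \<noteq> z" "(y, z) \<in> r" using u(1)[of z] y(1) by (auto simp: underS_def)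
      then have "ok c (p c) y (p c y)" using 1 y(1) uF by blast
      then have "BF (n - card (u y)) (p c ` u z)" unfolding ok_def eq by simp
      moreover have "card (u z) = Suc (card (u y))" unfolding eq using ny u(2) by simp
      \<comment> \<open>The bound on \<open>card (u z)\<close> keeps the truncated subtraction
        exact.\<close>
      then have "n - card (u y) = Suc (n - card (u z))" using u(3)[of z] by simp
      ultimately show ?thesis by simp
    qed
    have "\<exists>ab. ok c (p c) z ab"
    proof (cases "c z")
      case (Inl a)
      then have "a \<in> A" using c 1(2) by auto
      then show ?thesis using BF1[OF BF] Inl unfolding ok_def agrees_def by force
    next
      case (Inr b)
      then have "b \<in> B" using c 1(2) by auto
      then show ?thesis using BF2[OF BF] Inr unfolding ok_def agrees_def by force
    qed
    then show ?case unfolding p[of c z] by (rule someI_ex)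
  qed
  show ?thesis
    using causal ok unfolding ok_def answers_def by (intro exI[of _ p]) blast
qed

section \<open>Reduced products computed on representatives\<close>

lemma equiv_eq_mod: "equiv (\<Pi>\<^sub>E i\<in>I. S i) (eq_mod I D S)"
proof (rule equivI)
  show "eq_mod I D S \<subseteq> (\<Pi>\<^sub>E i\<in>I. S i) \<times> (\<Pi>\<^sub>E i\<in>I. S i)" by (auto simp: eq_mod_def)
  show "refl_on (\<Pi>\<^sub>E i\<in>I. S i) (eq_mod I D S)" by (auto simp: refl_on_def eq_mod_def)
  show "sym (eq_mod I D S)" by (auto simp: sym_def eq_mod_def eq_commute)
  show "trans (eq_mod I D S)"
  proof (rule transI)
    fix f g h assume *: "(f, g) \<in> eq_mod I D S" "(g, h) \<in> eq_mod I D S"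
    then have "\<forall>\<^sub>F i in D. f i = g i" "\<forall>\<^sub>F i in D. g i = h i" by (auto simp: eq_mod_def)
    then have "\<forall>\<^sub>F i in D. f i = h i" by eventually_elim simp
    then show "(f, h) \<in> eq_mod I D S" using * by (auto simp: eq_mod_def)
  qed
qed

definition rp_class ::
  "'i set \<Rightarrow> 'i filter \<Rightarrow> ('i \<Rightarrow> ('f, 'r, 'a) fo_structure) \<Rightarrow> ('i \<Rightarrow> 'a) \<Rightarrow> ('i \<Rightarrow> 'a) set" where
  "rp_class I D M f = eq_mod I D (\<lambda>i. universe (M i)) `` {f}"

lemma rp_class_in:
  assumes "f \<in> (\<Pi>\<^sub>E i\<in>I. universe (M i))"
  shows "rp_class I D M f \<in> universe (reduced_product I D M)"
  using assms by (auto simp: rp_class_def reduced_product_def Let_def intro: quotientI)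

lemma rp_class_eq_iff:
  assumes "f \<in> (\<Pi>\<^sub>E i\<in>I. universe (M i))" "g \<in> (\<Pi>\<^sub>E i\<in>I. universe (M i))"
  shows "rp_class I D M f = rp_class I D M g \<longleftrightarrow> (\<forall>\<^sub>F i in D. f i = g i)"
  unfolding rp_class_def eq_equiv_class_iff[OF equiv_eq_mod assms] using assms by (simp add: eq_mod_def)

lemma rp_representative:
  assumes "X \<in> universe (reduced_product I D M)"
  shows "(SOME f. f \<in> X) \<in> (\<Pi>\<^sub>E i\<in>I. universe (M i))" "rp_class I D M (SOME f. f \<in> X) = X"
proof -
  let ?E = "eq_mod I D (\<lambda>i. universe (M i))"
  have X: "X \<in> (\<Pi>\<^sub>E i\<in>I. universe (M i)) // ?E"
    using assms by (simp add: reduced_product_def Let_def)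
  then obtain f where f: "f \<in> (\<Pi>\<^sub>E i\<in>I. universe (M i))" "X = ?E `` {f}" by (rule quotientE)
  have "f \<in> X" using f equiv_class_self[OF equiv_eq_mod] by blast
  then have S: "(SOME f. f \<in> X) \<in> X" by (rule someI[of "\<lambda>f. f \<in> X"])
  then show "(SOME f. f \<in> X) \<in> (\<Pi>\<^sub>E i\<in>I. universe (M i))" using f(2) by (auto simp: eq_mod_def)
  show "rp_class I D M (SOME f. f \<in> X) = X"
  proof -
    have "(f, SOME f. f \<in> X) \<in> ?E" using S unfolding f(2) by (simp only: Image_singleton_iff)
    from equiv_class_eq[OF equiv_eq_mod this] show ?thesis by (simp only: rp_class_def f(2))
  qed
qed

text \<open>There are finitely many arguments, so the sets on which single representatives agree can
  be intersected within \<open>D\<close>. This is the atomic case of the theorem of Los, valid for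
  every filter.\<close>

lemma rel_interp_reduced_product:
  assumes fs: "set fs \<subseteq> (\<Pi>\<^sub>E i\<in>I. universe (M i))"
  shows "rel_interp (reduced_product I D M) R (map (rp_class I D M) fs) \<longleftrightarrow>
    (\<forall>\<^sub>F i in D. rel_interp (M i) R (map (\<lambda>f. f i) fs))"
proof
  assume "\<forall>\<^sub>F i in D. rel_interp (M i) R (map (\<lambda>f. f i) fs)"
  moreover have "list_all2 (\<in>) fs (map (rp_class I D M) fs)"
    using fs by (auto simp: list_all2_map2 list_all2_same rp_class_def eq_mod_def)
  ultimately show "rel_interp (reduced_product I D M) R (map (rp_class I D M) fs)"
    by (auto simp: reduced_product_def Let_def)
next
  assume "rel_interp (reduced_product I D M) R (map (rp_class I D M) fs)"
  then obtain gs where gs: "list_all2 (\<in>) gs (map (rp_class I D M) fs)"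
    and R: "\<forall>\<^sub>F i in D. rel_interp (M i) R (map (\<lambda>f. f i) gs)"
    by (auto simp: reduced_product_def Let_def)
  have "\<forall>\<^sub>F i in D. map (\<lambda>f. f i) gs = map (\<lambda>f. f i) fs"
    using gs
  proof (induction fs arbitrary: gs)
    case (Cons f fs)
    then obtain g gs' where g: "gs = g # gs'" "g \<in> rp_class I D M f"
      "list_all2 (\<in>) gs' (map (rp_class I D M) fs)"
      by (auto simp: list_all2_Cons2)
    then have "\<forall>\<^sub>F i in D. f i = g i" by (auto simp: rp_class_def eq_mod_def)
    moreover have "\<forall>\<^sub>F i in D. map (\<lambda>f. f i) gs' = map (\<lambda>f. f i) fs" by (rule Cons.IH[OF g(3)])
    ultimately show ?case by eventually_elim (simp add: g(1))
  qed simp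
  with R show "\<forall>\<^sub>F i in D. rel_interp (M i) R (map (\<lambda>f. f i) fs)"
    by eventually_elim simp
qed

text \<open>\<open>Rs\<close> is indexed injectively by \<open>q\<close>, and \<open>F i\<close>
  collects the symbols whose member of the regular family contains \<open>i\<close>.\<close>

lemma regular_filter_finite_subsets:
  assumes "Cinfinite lam" "regular_filter lam D" "|Rs| \<le>o lam"
  shows "\<exists>F. (\<forall>i\<in>Field lam. finite (F i) \<and> F i \<subseteq> Rs) \<and> (\<forall>R\<in>Rs. \<forall>\<^sub>F i in D. R \<in> F i)"
proof -
  have "|Rs| \<le>o |Field lam|"
    using assms(1,3) card_of_Field_ordIso ordIso_symmetric ordLeq_ordIso_trans by blast
  then obtain q where q: "inj_on q Rs" "q ` Rs \<subseteq> Field lam"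
    unfolding card_of_ordLeq[symmetric] by blast
  obtain A where A: "\<And>a. a \<in> Field lam \<Longrightarrow> \<forall>\<^sub>F i in D. i \<in> A a"
    and Afin: "\<And>i. i \<in> Field lam \<Longrightarrow> finite {a \<in> Field lam. i \<in> A a}"
    using assms(2) unfolding regular_filter_def by blast
  define F where "F i = {R \<in> Rs. i \<in> A (q R)}" for i
  have "finite (F i)" if "i \<in> Field lam" for i
  proof -
    have "q ` F i \<subseteq> {a \<in> Field lam. i \<in> A a}" using q(2) by (auto simp: F_def)
    then have "finite (q ` F i)" using Afin[OF that] finite_subset by blast
    moreover have "inj_on q (F i)" by (rule inj_on_subset[OF q(1)]) (auto simp: F_def)
    ultimately show ?thesis by (rule finite_imageD)
  qed
  moreover have "\<forall>\<^sub>F i in D. R \<in> F i" if "R \<in> Rs" for R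
    using A[of "q R"] q(2) that by (auto simp: F_def)
  ultimately show ?thesis by (intro exI[of _ F]) (auto simp: F_def)
qed


theorem theorem12:
  fixes lam :: "'l rel"
    and L :: "('f, 'r) vocabulary"
    and M :: "'l \<Rightarrow> ('f, 'r, 'a) fo_structure"
    and N :: "'l \<Rightarrow> ('f, 'r, 'b) fo_structure"
    and D :: "'l filter"
  assumes "Cinfinite lam"
    and "two_cardinal_transfer natLeq lam"
    and "relational L" and "|symbols L| \<le>o lam"
    and "\<And>i. i \<in> Field lam \<Longrightarrow> is_structure L (M i)"
    and "\<And>i. i \<in> Field lam \<Longrightarrow> is_structure L (N i)"
    and "\<And>i. i \<in> Field lam \<Longrightarrow> elementarily_equivalent L (M i) (N i)"
    and "regular_filter lam D"
  shows "II_wins_EFG (cardSuc lam) L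
    (reduced_product (Field lam) D M) (reduced_product (Field lam) D N)"
proof -
  let ?r = "cardSuc lam" and ?I = "Field lam"
  let ?M = "reduced_product ?I D M" and ?N = "reduced_product ?I D N"
  let ?cM = "rp_class ?I D M" and ?cN = "rp_class ?I D N"
  have wo: "Well_order ?r"
    using assms(1) cardSuc_Card_order by (auto simp: card_order_on_def)
  interpret wo: wo_rel ?r using wo by (simp add: wo_rel_def)
  have FD: "\<forall>\<^sub>F i in D. i \<in> ?I" using assms(8) by (simp add: regular_filter_def filter_on_def)
  have "|rels L| \<le>o |symbols L|" by (rule card_of_ordLeqI[of Inr]) auto
  then have "|rels L| \<le>o lam" using assms(4) ordLeq_transitive by blast
  then obtain F where F': "\<forall>i\<in>?I. finite (F i) \<and> F i \<subseteq> rels L"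
    and FR: "\<forall>R\<in>rels L. \<forall>\<^sub>F i in D. R \<in> F i"
    using regular_filter_finite_subsets[OF assms(1,8)] by blast
  have F: "finite (F i)" "F i \<subseteq> rels L" if "i \<in> ?I" for i
    using F' that by auto
  obtain u :: "'l \<Rightarrow> 'l set \<Rightarrow> 'l set set" and n where u: "\<forall>i z.
    u i z \<subseteq> underS ?r z \<and> finite (u i z) \<and> card (u i z) \<le> n i \<and>
    (\<forall>y\<in>u i z. u i y = u i z \<inter> underS ?r y) \<and>
    (\<forall>y\<in>underS ?r z. \<forall>\<^sub>F i in D. y \<in> u i z)"
    using finite_trees_exist[OF assms(1,2,8)] by (elim exE) (rule that)
  have uu: "u i z \<subseteq> underS ?r z" "finite (u i z)" "card (u i z) \<le> n i"
    and ucoh: "\<forall>y\<in>u i z. u i y = u i z \<inter> underS ?r y"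
    and uD': "\<forall>y\<in>underS ?r z. \<forall>\<^sub>F i in D. y \<in> u i z" for i z
    using u by auto
  have uD: "\<forall>\<^sub>F i in D. y \<in> u i z" if "y \<in> underS ?r z" for y z
    using uD' that by blast
  \<comment> \<open>Only the finitely many relations in \<open>F i\<close> are in force at
    coordinate \<open>i\<close>, so elementary equivalence supplies games of any finite
    length.\<close>
  define BF where "BF i k = back_and_forth k (L\<lparr>rels := F i\<rparr>) (M i) (N i)" for i k
  have "\<exists>p. answers ?r (u i) (n i) (universe (M i)) (universe (N i)) (BF i) p" if i: "i \<in> ?I" for i
  proof (rule answers_exist[OF wo])
    show "BF i (Suc (n i)) {}"
      unfolding BF_def by (rule elementarily_equivalent_back_and_forth[OF F[OF i] assms(5-7)[OF i]])
    show "\<exists>b\<in>universe (N i). BF i k (insert (a, b) \<pi>)" if "BF i (Suc k) \<pi>" "a \<in> universe (M i)" for k \<pi> a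
      using that by (simp add: BF_def)
    show "\<exists>a\<in>universe (M i). BF i k (insert (a, b) \<pi>)" if "BF i (Suc k) \<pi>" "b \<in> universe (N i)" for k \<pi> b
      using that by (simp add: BF_def)
    show "u i y = u i z \<inter> underS ?r y" if "y \<in> u i z" for y z
      using ucoh that by blast
  qed (fact uu)+
  then obtain p where p: "\<And>i. i \<in> ?I \<Longrightarrow>
      answers ?r (u i) (n i) (universe (M i)) (universe (N i)) (BF i) (p i)"
    by metis
  have pc: "p i c z = p i c' z"
    if "i \<in> ?I" "z \<in> Field ?r" "\<And>y. y \<in> under ?r z \<Longrightarrow> c y = c' y" for i z c c'
    using p[OF that(1)] that(2,3) unfolding answers_def by blast
  have pp: "p i c z \<in> universe (M i) \<times> universe (N i) \<and> agrees (c z) (p i c z) \<and>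
      BF i (n i - card (u i z)) (insert (p i c z) (p i c ` u i z))"
    if "i \<in> ?I" "\<And>z. z \<in> Field ?r \<Longrightarrow> c z \<in> universe (M i) <+> universe (N i)" "z \<in> Field ?r" for i c z
    using p[OF that(1)] that(2,3) unfolding answers_def by blast
  \<comment> \<open>Coordinate \<open>i\<close> of a move, through a chosen representative of its
    class.\<close>
  define lift :: "'l \<Rightarrow> ('l \<Rightarrow> 'a) set + ('l \<Rightarrow> 'b) set \<Rightarrow> 'a + 'b" where
    "lift i = map_sum (\<lambda>X. (SOME f. f \<in> X) i) (\<lambda>Y. (SOME g. g \<in> Y) i)" for i
  \<comment> \<open>The pairs of earlier rounds are recomputed by \<open>p\<close> from the moves of
    player I.\<close>
  define \<sigma> :: "('l set, ('l \<Rightarrow> 'a) set + ('l \<Rightarrow> 'b) set) strategy" where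
    "\<sigma> z x y = (case x z of
       Inl _ \<Rightarrow> Inr (?cN (\<lambda>i\<in>?I. snd (p i (lift i \<circ> x) z)))
     | Inr _ \<Rightarrow> Inl (?cM (\<lambda>i\<in>?I. fst (p i (lift i \<circ> x) z))))" for z x y
  show ?thesis
    unfolding II_wins_EFG_def
  proof (intro exI[of _ \<sigma>] allI impI)
    fix x y assume "I_legal ?r ?M ?N x \<and> follows ?r \<sigma> x y"
    then have x: "\<And>z. z \<in> Field ?r \<Longrightarrow> x z \<in> universe ?M <+> universe ?N"
      and y: "\<And>z. z \<in> Field ?r \<Longrightarrow> y z = \<sigma> z (restrict x (under ?r z)) (restrict y (underS ?r z))"
      by (auto simp: I_legal_def follows_def)
    define P where "P i z = p i (lift i \<circ> x) z" for i z
    have lift: "lift i (x z) \<in> universe (M i) <+> universe (N i)" if "i \<in> ?I" "z \<in> Field ?r" for i z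
      using x[OF that(2)] that(1) by (auto simp: lift_def intro: PiE_mem[OF rp_representative(1)])
    have PU: "P i z \<in> universe (M i) \<times> universe (N i)" and Pag: "agrees (lift i (x z)) (P i z)"
      and PBF: "BF i (n i - card (u i z)) (insert (P i z) (P i ` u i z))"
      if "i \<in> ?I" "z \<in> Field ?r" for i z
      using pp[OF that(1) _ that(2), of "lift i \<circ> x"] lift[OF that(1)] by (auto simp: P_def[abs_def])
    define f where "f z = (\<lambda>i\<in>?I. fst (P i z))" for z
    define g where "g z = (\<lambda>i\<in>?I. snd (P i z))" for z
    have fg: "f z \<in> (\<Pi>\<^sub>E i\<in>?I. universe (M i))" "g z \<in> (\<Pi>\<^sub>E i\<in>?I. universe (N i))"
      if "z \<in> Field ?r" for z
      using PU that by (auto simp: f_def g_def PiE_iff mem_Times_iff)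
    \<comment> \<open>The strategy sees the moves up to round \<open>z\<close> only; by
      \<open>pc\<close> later moves do not affect the coordinate pairs.\<close>
    have y': "y z = (case x z of Inl _ \<Rightarrow> Inr (?cN (g z)) | Inr _ \<Rightarrow> Inl (?cM (f z)))" if z: "z \<in> Field ?r" for z
    proof -
      have "z \<in> under ?r z" using wo.REFL z by (auto simp: under_def refl_on_def)
      moreover have "p i (lift i \<circ> restrict x (under ?r z)) z = P i z" if "i \<in> ?I" for i
        unfolding P_def by (rule pc[OF that z]) simp
      ultimately show ?thesis
        unfolding y[OF z] \<sigma>_def f_def g_def by (auto split: sum.splits cong: restrict_cong)
    qed
    \<comment> \<open>On the side where player I moved, \<open>agrees\<close> makes every coordinate
      that of the chosen representative, so the pair assembles to the move itself.\<close>
    have xl: "X = ?cM (f z)" if "z \<in> Field ?r" "x z = Inl X" for z X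
    proof -
      have X: "X \<in> universe ?M" using x[OF that(1)] that(2) by auto
      have "f z = (SOME h. h \<in> X)"
      proof (rule PiE_ext[OF fg(1)[OF that(1)] rp_representative(1)[OF X]])
        fix i assume "i \<in> ?I"
        then show "f z i = (SOME h. h \<in> X) i"
          using Pag[OF _ that(1), of i] that(2) by (simp add: f_def agrees_def lift_def)
      qed
      then show ?thesis using rp_representative(2)[OF X] by simp
    qed
    have xr: "Y = ?cN (g z)" if "z \<in> Field ?r" "x z = Inr Y" for z Y
    proof -
      have Y: "Y \<in> universe ?N" using x[OF that(1)] that(2) by auto
      have "g z = (SOME h. h \<in> Y)"
      proof (rule PiE_ext[OF fg(2)[OF that(1)] rp_representative(1)[OF Y]])
        fix i assume "i \<in> ?I"
        then show "g z i = (SOME h. h \<in> Y) i"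
          using Pag[OF _ that(1), of i] that(2) by (simp add: g_def agrees_def lift_def)
      qed
      then show ?thesis using rp_representative(2)[OF Y] by simp
    qed
    have played: "played_pairs ?r x y = (\<lambda>z. (?cM (f z), ?cN (g z))) ` Field ?r"
    proof (intro equalityI subsetI)
      fix q assume "q \<in> played_pairs ?r x y"
      then obtain z where z: "z \<in> Field ?r"
        "x z = Inl (fst q) \<and> y z = Inr (snd q) \<or> x z = Inr (snd q) \<and> y z = Inl (fst q)"
        by (auto simp: played_pairs_def)
      then have "q = (?cM (f z), ?cN (g z))"
        using y'[OF z(1)] xl[OF z(1)] xr[OF z(1)] by (auto simp: prod_eq_iff)
      then show "q \<in> (\<lambda>z. (?cM (f z), ?cN (g z))) ` Field ?r" using z(1) by blast
    next
      fix q assume "q \<in> (\<lambda>z. (?cM (f z), ?cN (g z))) ` Field ?r"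
      then obtain z where z: "z \<in> Field ?r" "q = (?cM (f z), ?cN (g z))" by blast
      then have "x z = Inl (fst q) \<and> y z = Inr (snd q) \<or> x z = Inr (snd q) \<and> y z = Inl (fst q)"
        using y'[OF z(1)] xl[OF z(1)] xr[OF z(1)] by (cases "x z") auto
      then show "q \<in> played_pairs ?r x y" using z(1) by (auto simp: played_pairs_def)
    qed
    \<comment> \<open>Finitely many rounds have a largest one \<open>z\<close>; at almost all
      coordinates the others lie in \<open>u i z\<close>, hence in the position kept by round
      \<open>z\<close>.\<close>
    have iso: "\<forall>\<^sub>F i in D. i \<in> ?I \<and> partial_isomorphism (L\<lparr>rels := F i\<rparr>) (M i) (N i) (P i ` Z)"
      if Z: "finite Z" "Z \<subseteq> Field ?r" for Z
    proof -
      have "\<exists>z. z \<in> Field ?r \<and> Z \<subseteq> insert z (underS ?r z)" if "Z \<noteq> {}"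
        using well_order_finite_max[OF wo Z(1) that Z(2)] Z(2) by (auto simp: underS_def)
      \<comment> \<open>Supplies \<open>z\<close> for empty \<open>Z\<close>, which occurs for
        relation symbols of arity 0.\<close>
      moreover have "\<exists>z. z \<in> Field ?r"
        using cardSuc_finite[of lam] assms(1) by (metis cinfinite_def ex_in_conv finite.emptyI)
      ultimately obtain z where z: "z \<in> Field ?r" "Z \<subseteq> insert z (underS ?r z)" by blast
      have "\<forall>\<^sub>F i in D. \<forall>w\<in>Z - {z}. w \<in> u i z"
        using Z(1) z(2) uD by (intro eventually_ball_finite) auto
      with FD show ?thesis
      proof eventually_elim
        case (elim i)
        have "universe (M i) \<noteq> {}" using assms(5)[OF elim(1)] by (simp add: is_structure_def)
        then have "partial_isomorphism (L\<lparr>rels := F i\<rparr>) (M i) (N i) (insert (P i z) (P i ` u i z))"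
          using PBF[OF elim(1) z(1)] back_and_forth_partial_isomorphism unfolding BF_def by blast
        then have "partial_isomorphism (L\<lparr>rels := F i\<rparr>) (M i) (N i) (P i ` Z)"
          by (rule partial_isomorphism_subset) (use elim(2) in blast)
        then show ?case using elim(1) by blast
      qed
    qed
    have "II_legal ?r ?M ?N x y"
      unfolding II_legal_def using y' rp_class_in[OF fg(1)] rp_class_in[OF fg(2)]
      by (auto split: sum.splits)
    moreover have "partial_isomorphism L ?M ?N (played_pairs ?r x y)"
      unfolding partial_isomorphism_def played
    proof (intro conjI)
      show "(\<lambda>z. (?cM (f z), ?cN (g z))) ` Field ?r \<subseteq> universe ?M \<times> universe ?N"
        using rp_class_in[OF fg(1)] rp_class_in[OF fg(2)] by auto
    next
      have "?cM (f z) = ?cM (f w) \<longleftrightarrow> ?cN (g z) = ?cN (g w)" if zw: "z \<in> Field ?r" "w \<in> Field ?r" for z w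
      proof -
        \<comment> \<open>\<open>D\<close> need not be an ultrafilter: the equivalence is first
          proved at almost all coordinates, and only then is each side taken almost
          everywhere.\<close>
        have "\<forall>\<^sub>F i in D. f z i = f w i \<longleftrightarrow> g z i = g w i"
          using iso[of "{z, w}"] zw
          by (auto elim!: eventually_mono simp: f_def g_def
              dest: partial_isomorphism_eq_iff[where p = "P _ z" and q = "P _ w"])
        then show ?thesis
          unfolding rp_class_eq_iff[OF fg(1)[OF zw(1)] fg(1)[OF zw(2)]]
            rp_class_eq_iff[OF fg(2)[OF zw(1)] fg(2)[OF zw(2)]]
          by (rule eventually_subst)
      qed
      then show "\<forall>(a, b)\<in>(\<lambda>z. (?cM (f z), ?cN (g z))) ` Field ?r.
          \<forall>(a', b')\<in>(\<lambda>z. (?cM (f z), ?cN (g z))) ` Field ?r. (a = a') = (b = b')"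
        by simp
    next
      show "\<forall>R\<in>rels L. \<forall>ps\<in>lists ((\<lambda>z. (?cM (f z), ?cN (g z))) ` Field ?r).
          length ps = rel_arity L R \<longrightarrow> rel_interp ?M R (map fst ps) = rel_interp ?N R (map snd ps)"
      proof (intro ballI impI)
        fix R ps assume R: "R \<in> rels L" and ps: "ps \<in> lists ((\<lambda>z. (?cM (f z), ?cN (g z))) ` Field ?r)"
          and len: "length ps = rel_arity L R"
        obtain zs where zs: "ps = map (\<lambda>z. (?cM (f z), ?cN (g z))) zs" "set zs \<subseteq> Field ?r"
          using ps by (auto simp: lists_image in_lists_conv_set)
        \<comment> \<open>Almost all \<open>F i\<close> contain \<open>R\<close>, and the arguments
          involve only the finitely many rounds in \<open>zs\<close>, so \<open>iso\<close>
          applies.\<close>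
        have "\<forall>\<^sub>F i in D. rel_interp (M i) R (map (\<lambda>h. h i) (map f zs)) \<longleftrightarrow>
            rel_interp (N i) R (map (\<lambda>h. h i) (map g zs))"
          using bspec[OF FR R] iso[of "set zs", OF finite_set zs(2)]
        proof eventually_elim
          case (elim i)
          have "rel_interp (M i) R (map fst (map (P i) zs)) \<longleftrightarrow>
              rel_interp (N i) R (map snd (map (P i) zs))"
            by (rule partial_isomorphism_rel[OF conjunct2[OF elim(2)]]) (use elim(1) len zs(1) in auto)
          moreover have "map (\<lambda>h. h i) (map f zs) = map fst (map (P i) zs)"
            "map (\<lambda>h. h i) (map g zs) = map snd (map (P i) zs)"
            using elim by (simp_all add: f_def g_def)
          ultimately show ?case by (simp only:)
        qed
        then have "(\<forall>\<^sub>F i in D. rel_interp (M i) R (map (\<lambda>h. h i) (map f zs))) \<longleftrightarrow>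
            (\<forall>\<^sub>F i in D. rel_interp (N i) R (map (\<lambda>h. h i) (map g zs)))"
          by (rule eventually_subst)
        moreover have "map fst ps = map ?cM (map f zs)" "map snd ps = map ?cN (map g zs)"
          by (simp_all add: zs(1))
        moreover have "set (map f zs) \<subseteq> (\<Pi>\<^sub>E i\<in>?I. universe (M i))" "set (map g zs) \<subseteq> (\<Pi>\<^sub>E i\<in>?I. universe (N i))"
          using fg zs(2) by auto
        ultimately show "rel_interp ?M R (map fst ps) = rel_interp ?N R (map snd ps)"
          by (simp only: rel_interp_reduced_product)
      qed
    qed
    ultimately show "II_legal ?r ?M ?N x y \<and> partial_isomorphism L ?M ?N (played_pairs ?r x y)" by blast
  qed
qed

end
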